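(* Let $\mathcal{S}$ be a connected rotationally symmetric semi-quadratic Weingarten surface for which $\Lambda_1^2=\Lambda_2$. Then $\mathcal{S}$ is a subset of a torus of revolution, round sphere, plane, cone or cylinder.
   Context: Surfaces are $C^2$-smooth oriented surfaces in Euclidean 3-space. For a surface of revolution, $k_1$ and $k_2$ denote the principal curvatures along the parallels and along the profile curves respectively. A semi-quadratic Weingarten surface is a surface whose principal curvatures satisfy, at every point, a relation $\alpha k_1k_2+\beta k_1+\gamma k_2+\delta=0$ with fixed real constants $\alpha,\beta,\gamma,\delta$, not all zero. For such a relation, $\Lambda_1=\beta-\gamma$ and $\Lambda_2=(\beta+\gamma)^2-4\alpha\delta$. A torus of revolution is the surface obtained by revolving a circle about a line in its plane. *)

theory Defs
  imports "HOL-Analysis.Analysis"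
begin

section \<open>Oriented surfaces in Euclidean 3-space\<close>

definition C2_on :: "(real^2 \<Rightarrow> real^3) \<Rightarrow> (real^2) set \<Rightarrow> bool" where
  "C2_on X D \<longleftrightarrow>
     (\<exists>(X' :: real^2 \<Rightarrow> ((real^2) \<Rightarrow>\<^sub>L (real^3)))
      (X'' :: real^2 \<Rightarrow> ((real^2) \<Rightarrow>\<^sub>L ((real^2) \<Rightarrow>\<^sub>L (real^3)))).
        (\<forall>u\<in>D. (X has_derivative blinfun_apply (X' u)) (at u) \<and>
               (X' has_derivative blinfun_apply (X'' u)) (at u)) \<and>
        continuous_on D X'')"

text \<open>
  Surfaces are immersed: a surface is a topological 2-manifold \<open>M\<close> with a map \<open>F\<close> from \<open>M\<close> to
  space that is a regular \<open>C\<^sup>2\<close> parametrisation in suitable local coordinates.  The maps \<open>F\<close> read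
  in coordinates determine the \<open>C\<^sup>2\<close> structure of \<open>M\<close>: any two charts in the sense below are
  \<open>C\<^sup>2\<close>-compatible, because \<open>F\<close> is locally an embedding.  An embedded surface \<open>S\<close> is the case
  \<open>M = top_of_set S\<close>, \<open>F = id\<close>.
\<close>

definition C2_chart :: "'m topology \<Rightarrow> ('m \<Rightarrow> real^3) \<Rightarrow> (real^2) set \<Rightarrow> (real^2 \<Rightarrow> 'm) \<Rightarrow> bool" where
  "C2_chart M F D \<phi> \<longleftrightarrow>
     open D \<and> embedding_map (top_of_set D) M \<phi> \<and> openin M (\<phi> ` D) \<and>
     C2_on (F \<circ> \<phi>) D \<and> (\<forall>u\<in>D. inj (frechet_derivative (F \<circ> \<phi>) (at u)))"

definition tangent_plane :: "'m topology \<Rightarrow> ('m \<Rightarrow> real^3) \<Rightarrow> 'm \<Rightarrow> (real^3) set" where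
  "tangent_plane M F p =
     {w. \<exists>D \<phi> u \<xi>. C2_chart M F D \<phi> \<and> u \<in> D \<and> \<phi> u = p \<and>
                    w = frechet_derivative (F \<circ> \<phi>) (at u) \<xi>}"

text \<open>\<open>N\<close> is the unit normal field that gives the orientation.\<close>

definition oriented_C2_surface ::
    "'m topology \<Rightarrow> ('m \<Rightarrow> real^3) \<Rightarrow> ('m \<Rightarrow> real^3) \<Rightarrow> bool" where
  "oriented_C2_surface M F N \<longleftrightarrow>
     Hausdorff_space M \<and> second_countable M \<and>
     (\<forall>p\<in>topspace M. \<exists>D \<phi>. C2_chart M F D \<phi> \<and> p \<in> \<phi> ` D) \<and>
     continuous_map M euclidean N \<and>
     (\<forall>p\<in>topspace M. norm (N p) = 1 \<and> (\<forall>w\<in>tangent_plane M F p. N p \<bullet> w = 0))"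


section \<open>Principal curvatures\<close>

text \<open>The derivative at \<open>p\<close> of the map \<open>G\<close> on the surface, in the tangent direction \<open>w\<close>, is \<open>v\<close>.\<close>

definition has_surface_derivative ::
    "'m topology \<Rightarrow> ('m \<Rightarrow> real^3) \<Rightarrow> ('m \<Rightarrow> real^3) \<Rightarrow> 'm \<Rightarrow> real^3 \<Rightarrow> real^3 \<Rightarrow> bool" where
  "has_surface_derivative M F G p w v \<longleftrightarrow>
     w \<in> tangent_plane M F p \<and>
     (\<forall>D \<phi> u \<xi>. C2_chart M F D \<phi> \<and> u \<in> D \<and> \<phi> u = p \<and>
                 frechet_derivative (F \<circ> \<phi>) (at u) \<xi> = w \<longrightarrow>
        (G \<circ> \<phi>) differentiable (at u) \<and> frechet_derivative (G \<circ> \<phi>) (at u) \<xi> = v)"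

text \<open>
  \<open>w\<close> is an eigenvector, with eigenvalue \<open>k\<close>, of the shape operator \<open>-dN\<close> at \<open>p\<close>.
\<close>

definition principal_curvature ::
    "'m topology \<Rightarrow> ('m \<Rightarrow> real^3) \<Rightarrow> ('m \<Rightarrow> real^3) \<Rightarrow> 'm \<Rightarrow> real^3 \<Rightarrow> real \<Rightarrow> bool" where
  "principal_curvature M F N p w k \<longleftrightarrow>
     w \<noteq> 0 \<and> has_surface_derivative M F N p w (- k *\<^sub>R w)"


section \<open>Rotational symmetry\<close>

text \<open>
  Throughout, the axis is the line through \<open>q\<close> with unit direction \<open>e\<close>.  The rotation by the
  angle \<open>t\<close> about it is given by Rodrigues' formula.
\<close>

definition rotate_axis :: "real^3 \<Rightarrow> real^3 \<Rightarrow> real \<Rightarrow> real^3 \<Rightarrow> real^3" where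
  "rotate_axis q e t x =
     q + cos t *\<^sub>R (x - q) + sin t *\<^sub>R cross3 e (x - q) + ((1 - cos t) * (e \<bullet> (x - q))) *\<^sub>R e"

text \<open>
  The rotations about the axis act continuously on the surface.  The action is one of the additive
  group of angles in \<open>\<real>\<close>; periodicity in \<open>t\<close> is not demanded, so that surfaces winding several (even
  infinitely many) times around the axis are included.
\<close>

definition rotationally_symmetric ::
    "'m topology \<Rightarrow> ('m \<Rightarrow> real^3) \<Rightarrow> real^3 \<Rightarrow> real^3 \<Rightarrow> bool" where
  "rotationally_symmetric M F q e \<longleftrightarrow>
     norm e = 1 \<and>
     (\<exists>\<rho> :: real \<Rightarrow> 'm \<Rightarrow> 'm.
        continuous_map (prod_topology euclideanreal M) M (\<lambda>(t, p). \<rho> t p) \<and>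
        (\<forall>p\<in>topspace M. \<rho> 0 p = p) \<and>
        (\<forall>s t. \<forall>p\<in>topspace M. \<rho> (s + t) p = \<rho> s (\<rho> t p)) \<and>
        (\<forall>t. \<forall>p\<in>topspace M. F (\<rho> t p) = rotate_axis q e t (F p)))"

lemma rotate_axis_0: "rotate_axis q e 0 x = x"
  by (simp add: rotate_axis_def)

lemma rotate_axis_add:
  assumes "norm e = 1"
  shows "rotate_axis q e (s + t) x = rotate_axis q e s (rotate_axis q e t x)"
proof -
  define y where "y = x - q"
  have e: "e \<bullet> e = 1" using assms by (simp add: dot_square_norm)
  have c: "cross3 e (cross3 e y) = (e \<bullet> y) *\<^sub>R e - y"
    using e by (simp add: Lagrange)
  have d: "e \<bullet> (rotate_axis q e t x - q) = e \<bullet> y"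
    by (simp add: rotate_axis_def y_def[symmetric] inner_add_right dot_cross_self e algebra_simps)
  have r: "cross3 e (rotate_axis q e t x - q) = cos t *\<^sub>R cross3 e y + sin t *\<^sub>R ((e \<bullet> y) *\<^sub>R e - y)"
    by (simp add: rotate_axis_def y_def[symmetric] add_diff_eq[symmetric] cross_add_right
        cross_mult_right c del: diff_add_eq)
  have "rotate_axis q e s (rotate_axis q e t x) =
      q + cos s *\<^sub>R (rotate_axis q e t x - q)
        + sin s *\<^sub>R (cos t *\<^sub>R cross3 e y + sin t *\<^sub>R ((e \<bullet> y) *\<^sub>R e - y))
        + ((1 - cos s) * (e \<bullet> y)) *\<^sub>R e"
    unfolding rotate_axis_def[of q e s "rotate_axis q e t x"] d r ..
  also have "\<dots> = rotate_axis q e (s + t) x"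
    unfolding rotate_axis_def y_def[symmetric]
    by (simp add: cos_add sin_add scaleR_add_right scaleR_diff_right scaleR_add_left
        scaleR_diff_left algebra_simps)
  finally show ?thesis by simp
qed

text \<open>A set invariant under the rotations about an axis is rotationally symmetric.\<close>

lemma rotationally_symmetric_subset:
  assumes "norm e = 1" and "\<And>t x. x \<in> S \<Longrightarrow> rotate_axis q e t x \<in> S"
  shows "rotationally_symmetric (top_of_set S) id q e"
proof -
  have "continuous_on (UNIV \<times> S) (\<lambda>(t, p). rotate_axis q e t p)"
    unfolding rotate_axis_def case_prod_unfold
    by (intro continuous_intros continuous_on_cross)
  hence "continuous_map (prod_topology euclideanreal (top_of_set S)) (top_of_set S)
      (\<lambda>(t, p). rotate_axis q e t p)"
    using assms(2) by (force simp: prod_topology_subtopology euclidean_product_topology)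
  then show ?thesis
    unfolding rotationally_symmetric_def using assms
    by (auto simp: rotate_axis_0 rotate_axis_add intro!: exI[of _ "rotate_axis q e"])
qed

text \<open>
  Principal curvature along the parallel through \<open>p\<close>: the tangent vectors of the parallel are the
  tangent vectors orthogonal both to the axis and to the position vector relative to the axis.
  At a point on the axis the parallel degenerates to a point; the tangent plane is orthogonal to
  the axis there, so every tangent direction is admitted below, and the point is umbilic.
\<close>

definition parallel_curvature ::
    "'m topology \<Rightarrow> ('m \<Rightarrow> real^3) \<Rightarrow> ('m \<Rightarrow> real^3) \<Rightarrow> real^3 \<Rightarrow> real^3 \<Rightarrow> 'm \<Rightarrow> real \<Rightarrow> bool" where
  "parallel_curvature M F N q e p k \<longleftrightarrow>
     (\<forall>w\<in>tangent_plane M F p. w \<noteq> 0 \<and> w \<bullet> e = 0 \<and> w \<bullet> (F p - q) = 0 \<longrightarrow>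
        principal_curvature M F N p w k)"

text \<open>
  Principal curvature along the profile curve through \<open>p\<close>, which lies in the plane spanned by the
  axis and \<open>F p\<close>.  On the axis, profile curves leave in all tangent directions.
\<close>

definition profile_curvature ::
    "'m topology \<Rightarrow> ('m \<Rightarrow> real^3) \<Rightarrow> ('m \<Rightarrow> real^3) \<Rightarrow> real^3 \<Rightarrow> real^3 \<Rightarrow> 'm \<Rightarrow> real \<Rightarrow> bool" where
  "profile_curvature M F N q e p k \<longleftrightarrow>
     (\<forall>w\<in>tangent_plane M F p. w \<noteq> 0 \<and> w \<bullet> cross3 e (F p - q) = 0 \<longrightarrow>
        principal_curvature M F N p w k)"

definition semi_quadratic_Weingarten ::
    "'m topology \<Rightarrow> ('m \<Rightarrow> real^3) \<Rightarrow> ('m \<Rightarrow> real^3) \<Rightarrow> real^3 \<Rightarrow> real^3 \<Rightarrow>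
     real \<Rightarrow> real \<Rightarrow> real \<Rightarrow> real \<Rightarrow> bool" where
  "semi_quadratic_Weingarten M F N q e \<alpha> \<beta> \<gamma> \<delta> \<longleftrightarrow>
     \<not> (\<alpha> = 0 \<and> \<beta> = 0 \<and> \<gamma> = 0 \<and> \<delta> = 0) \<and>
     (\<forall>p\<in>topspace M. \<exists>k\<^sub>1 k\<^sub>2. parallel_curvature M F N q e p k\<^sub>1 \<and>
        profile_curvature M F N q e p k\<^sub>2 \<and>
        \<alpha> * k\<^sub>1 * k\<^sub>2 + \<beta> * k\<^sub>1 + \<gamma> * k\<^sub>2 + \<delta> = 0)"

definition Lambda1 :: "real \<Rightarrow> real \<Rightarrow> real" where
  "Lambda1 \<beta> \<gamma> = \<beta> - \<gamma>"

definition Lambda2 :: "real \<Rightarrow> real \<Rightarrow> real \<Rightarrow> real \<Rightarrow> real" where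
  "Lambda2 \<alpha> \<beta> \<gamma> \<delta> = (\<beta> + \<gamma>)\<^sup>2 - 4 * \<alpha> * \<delta>"


section \<open>Model surfaces\<close>

text \<open>
  The circle has centre \<open>c\<close> and radius \<open>r\<close> and lies in the plane through \<open>q\<close> with unit normal \<open>n\<close>,
  which contains the axis.  As the circle may meet the axis, horn and spindle tori are included.
\<close>

definition torus_of_revolution :: "(real^3) set \<Rightarrow> bool" where
  "torus_of_revolution T \<longleftrightarrow>
     (\<exists>q e n c r. norm e = 1 \<and> norm n = 1 \<and> n \<bullet> e = 0 \<and> n \<bullet> (c - q) = 0 \<and> r > 0 \<and>
        T = (\<Union>t. rotate_axis q e t ` (sphere c r \<inter> {x. n \<bullet> (x - q) = 0})))"

definition round_sphere :: "(real^3) set \<Rightarrow> bool" where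
  "round_sphere T \<longleftrightarrow> (\<exists>c r. r > 0 \<and> T = sphere c r)"

definition plane :: "(real^3) set \<Rightarrow> bool" where
  "plane T \<longleftrightarrow> (\<exists>q n. n \<noteq> 0 \<and> T = {x. n \<bullet> (x - q) = 0})"

text \<open>One nappe of a circular cone with apex \<open>v\<close> and half opening angle \<open>\<omega>\<close>.\<close>

definition circular_cone :: "(real^3) set \<Rightarrow> bool" where
  "circular_cone T \<longleftrightarrow> (\<exists>v e \<omega>. norm e = 1 \<and> 0 < \<omega> \<and> \<omega> < pi / 2 \<and>
     T = {x. e \<bullet> (x - v) = cos \<omega> * norm (x - v)})"

text \<open>Circular cylinder: the norm below is the distance of \<open>x\<close> from the axis.\<close>

definition cylinder :: "(real^3) set \<Rightarrow> bool" where
  "cylinder T \<longleftrightarrow> (\<exists>q e r. norm e = 1 \<and> r > 0 \<and> T = {x. norm (cross3 e (x - q)) = r})"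

end

(*
  The condition Lambda1^2 = Lambda2 says beta*gamma = alpha*delta, so the Weingarten relation splits
  into linear factors: at every point k1 = a or k2 = b for fixed constants a, b.

  Let tau = e x (F - q) be the rotation field.  Rotational symmetry enters only through the tangency
  N . tau = 0, whose derivative gives k1 |tau|^2 = N . (e x tau).  On an open set where k1 = a, k2 is
  neither a nor b and tau does not vanish, differentiating this identity along the profile direction
  N x tau yields N . e = 0, hence k2 = 0.  At points of the axis k1 = k2.  So k2 takes values in
  {0, a, b} only; as its level sets are closed, k2 is a constant c on the connected surface.

  If c is nonzero, the centres of curvature F + N/c lie on one circle about the axis (or are one
  point of the axis), which gives a torus or a sphere.  If c = 0, then N . e and N . (F - q) are
  constant, which gives a plane, cone or cylinder.
*)
theory Submission
  imports Defs
begin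

section \<open>Vectors in Euclidean 3-space\<close>

lemma has_derivative_cross3_right [derivative_intros]:
  assumes "(f has_derivative f') F"
  shows "((\<lambda>x. cross3 e (f x)) has_derivative (\<lambda>x. cross3 e (f' x))) F"
proof -
  have "linear (cross3 e)"
    by (intro linearI cross_add_right cross_mult_right)
  then show ?thesis
    using assms bounded_linear.has_derivative linear_conv_bounded_linear by blast
qed

text \<open>By Lagrange's formula the first two conditions make \<open>w\<close> parallel to
  \<open>cross3 a b\<close>; the third makes it orthogonal to that nonzero vector.\<close>

lemma eq_zero_if_orthogonal:
  fixes w a b :: "real^3"
  assumes "w \<bullet> a = 0" "w \<bullet> b = 0" "w \<bullet> cross3 a b = 0" "cross3 a b \<noteq> 0"
  shows "w = 0"
proof -
  have "cross3 w (cross3 a b) = 0"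
    using assms by (simp add: Lagrange)
  then show ?thesis
    using assms(3,4) norm_and_cross_eq_0 by blast
qed

lemma cross3_unit_orthogonal:
  fixes e a :: "real^3"
  assumes "norm e = 1" "a \<bullet> e = 0"
  shows "norm (cross3 e a) = norm a"
proof -
  have "(norm (cross3 e a))\<^sup>2 = (norm a)\<^sup>2"
    using assms by (simp add: norm_cross inner_commute)
  then show ?thesis by simp
qed

lemma orthogonal_frame_expansion:
  fixes e a y :: "real^3"
  assumes e: "norm e = 1" and a: "a \<bullet> e = 0" "a \<noteq> 0"
  shows "y = (y \<bullet> e) *\<^sub>R e + ((y \<bullet> a) / (a \<bullet> a)) *\<^sub>R a
           + ((y \<bullet> cross3 e a) / (a \<bullet> a)) *\<^sub>R cross3 e a"
proof -
  have ee: "e \<bullet> e = 1" and cc: "cross3 e a \<bullet> cross3 e a = a \<bullet> a"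
    using e a cross3_unit_orthogonal[OF e a(1)] by (simp_all add: dot_square_norm)
  have 0: "a \<bullet> a \<noteq> 0" "cross3 e a \<noteq> 0" using a cc by auto
  let ?d = "y - ((y \<bullet> e) *\<^sub>R e + ((y \<bullet> a) / (a \<bullet> a)) *\<^sub>R a
           + ((y \<bullet> cross3 e a) / (a \<bullet> a)) *\<^sub>R cross3 e a)"
  have "?d = 0"
    by (rule eq_zero_if_orthogonal[of _ e a])
      (use 0 ee cc a in \<open>simp_all add: inner_diff_left inner_add_left dot_cross_self
        inner_commute[of e a]\<close>)
  then show ?thesis by simp
qed

text \<open>The kernel of a functional on the plane has dimension at least one. This supplies
  profile directions uniformly, including on the axis, where the functional in question
  vanishes.\<close>

lemma exists_unit_kernel_vector:
  fixes f :: "real^2 \<Rightarrow> real"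
  assumes "linear f"
  shows "\<exists>\<xi>. norm \<xi> = 1 \<and> f \<xi> = 0"
proof -
  obtain y where y: "y \<noteq> 0" "orthogonal (adjoint f 1) y"
    using orthogonal_to_vector_exists[of "adjoint f 1"] by auto
  then have "f y = 0"
    using adjoint_works[OF assms, of y 1] by (simp add: orthogonal_def inner_commute)
  then show ?thesis
    using y assms
    by (intro exI[of _ "(1 / norm y) *\<^sub>R y"]) (simp add: linear_cmul)
qed


section \<open>Charts\<close>

lemma C2_chart_topspace: "C2_chart M F D \<phi> \<Longrightarrow> u \<in> D \<Longrightarrow> \<phi> u \<in> topspace M"
  unfolding C2_chart_def using openin_subset by blast

lemma C2_chart_homeomorphic_map:
  "C2_chart M F D \<phi> \<Longrightarrow> homeomorphic_map (top_of_set D) (subtopology M (\<phi> ` D)) \<phi>"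
  by (simp add: C2_chart_def embedding_map_def)

lemma C2_chart_open_image:
  assumes "C2_chart M F D \<phi>" "openin (top_of_set D) U"
  shows "openin M (\<phi> ` U)"
proof -
  have "openin (subtopology M (\<phi> ` D)) (\<phi> ` U)"
    using C2_chart_homeomorphic_map[OF assms(1)] assms(2)
    by (meson homeomorphic_imp_open_map open_map_def)
  then show ?thesis
    using assms(1) by (auto simp: C2_chart_def intro: openin_trans_full)
qed

lemma C2_chart_open_vimage:
  assumes "C2_chart M F D \<phi>" "openin M U"
  shows "open {u \<in> D. \<phi> u \<in> U}"
proof -
  have "continuous_map (top_of_set D) M \<phi>"
    using C2_chart_homeomorphic_map[OF assms(1)] continuous_map_in_subtopology
      homeomorphic_imp_continuous_map by blast
  then have "openin (top_of_set D) {u \<in> topspace (top_of_set D). \<phi> u \<in> U}"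
    using assms(2) openin_continuous_map_preimage by blast
  then show ?thesis
    using assms(1) by (simp add: C2_chart_def openin_open_eq)
qed

text \<open>A curve in the surface is only assumed continuous here; since the immersion is locally
  bi-Lipschitz, differentiability of its image in space suffices.\<close>

lemma curve_velocity_orthogonal:
  fixes Y :: "real \<Rightarrow> real^3"
  assumes chart: "C2_chart M F D \<phi>" and u: "u \<in> D"
    and nu: "\<And>\<xi>. \<nu> \<bullet> frechet_derivative (F \<circ> \<phi>) (at u) \<xi> = 0"
    and c: "continuous_map euclideanreal M c" "c 0 = \<phi> u"
    and Y: "\<And>t. F (c t) = Y t" "(Y has_vector_derivative y) (at 0)"
  shows "\<nu> \<bullet> y = 0"
proof -
  define X where "X = F \<circ> \<phi>"
  define A where "A = frechet_derivative X (at u)"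
  have X: "(X has_derivative A) (at u)"
    using chart u unfolding C2_chart_def C2_on_def X_def A_def
    by (metis frechet_derivative_works differentiableI)
  have "linear A" using X has_derivative_linear by blast
  moreover have "inj A" using chart u by (auto simp: C2_chart_def A_def X_def)
  ultimately obtain \<kappa> where \<kappa>: "\<kappa> > 0" "\<And>\<xi>. \<kappa> * norm \<xi> \<le> norm (A \<xi>)"
    using linear_inj_bounded_below_pos by blast
  have bound: "\<bar>\<nu> \<bullet> y\<bar> \<le> \<epsilon> * norm y" if "\<epsilon> > 0" for \<epsilon>
  proof -
    \<comment> \<open>The first bound keeps the linearisation error below half of
      \<open>\<kappa> * norm (v - u)\<close>; the second keeps its component along
      \<open>\<nu>\<close> below \<open>\<epsilon>\<close> times the same quantity.\<close>
    define \<epsilon>' where "\<epsilon>' = min (\<kappa> / 2) (\<epsilon> * \<kappa> / (2 * (norm \<nu> + 1)))"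
    have nn: "norm \<nu> + 1 > 0" by (smt (verit) norm_ge_zero)
    have e': "\<epsilon>' > 0" "\<epsilon>' \<le> \<kappa> / 2"
      using that \<kappa>(1) nn unfolding \<epsilon>'_def by simp (rule min.cobounded1)
    have "\<epsilon>' * (norm \<nu> + 1) \<le> \<epsilon> * \<kappa> / 2"
    proof -
      have "\<epsilon>' \<le> \<epsilon> * \<kappa> / (2 * (norm \<nu> + 1))" unfolding \<epsilon>'_def by simp
      then have "\<epsilon>' * (norm \<nu> + 1) \<le> \<epsilon> * \<kappa> / (2 * (norm \<nu> + 1)) * (norm \<nu> + 1)"
        using nn by (intro mult_right_mono) auto
      also have "\<dots> = \<epsilon> * \<kappa> / 2" using nn by (simp add: field_simps)
      finally show ?thesis .
    qed
    then have e'2: "\<epsilon>' * norm \<nu> \<le> \<epsilon> * \<kappa> / 2" using e' by (simp add: algebra_simps)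
    obtain d where d: "d > 0" "\<And>v. norm (v - u) < d \<Longrightarrow>
        norm (X v - X u - A (v - u)) \<le> \<epsilon>' * norm (v - u)"
      using X e'(1) unfolding has_derivative_at_alt by blast
    \<comment> \<open>Injectivity of \<open>A\<close> bounds \<open>norm (v - u)\<close> by a
      multiple of the chord length, so the chord itself controls its own component along
      \<open>\<nu>\<close>.\<close>
    have near: "\<bar>\<nu> \<bullet> (X v - X u)\<bar> \<le> \<epsilon> * norm (X v - X u)" if "norm (v - u) < d" for v
    proof -
      have "\<kappa> * norm (v - u) \<le> norm (A (v - u))" using \<kappa> by blast
      also have "\<dots> \<le> norm (X v - X u) + norm (X v - X u - A (v - u))"
        by (metis norm_minus_commute norm_triangle_sub add.commute)
      also have "\<dots> \<le> norm (X v - X u) + \<kappa> / 2 * norm (v - u)"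
        using d(2)[OF that] e'(2) by (smt (verit) mult_right_mono norm_ge_zero)
      finally have 1: "\<kappa> / 2 * norm (v - u) \<le> norm (X v - X u)" by (simp add: field_simps)
      have "\<nu> \<bullet> (X v - X u) = \<nu> \<bullet> (X v - X u - A (v - u))"
        using nu[of "v - u"] by (simp add: inner_diff_right A_def X_def)
      also have "\<bar>\<dots>\<bar> \<le> norm \<nu> * norm (X v - X u - A (v - u))"
        by (rule Cauchy_Schwarz_ineq2)
      also have "\<dots> \<le> norm \<nu> * (\<epsilon>' * norm (v - u))"
        using d(2)[OF that] by (simp add: mult_left_mono)
      also have "\<dots> \<le> \<epsilon> * \<kappa> / 2 * norm (v - u)"
        using mult_right_mono[OF e'2, of "norm (v - u)"] by (simp add: algebra_simps)
      also have "\<dots> \<le> \<epsilon> * norm (X v - X u)"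
        using mult_left_mono[OF 1, of \<epsilon>] \<open>\<epsilon> > 0\<close> by (simp add: algebra_simps)
      finally show ?thesis .
    qed
    \<comment> \<open>Continuity of \<open>c\<close> puts its nearby points in this patch, where the
      chord estimate applies. Dividing by \<open>t\<close> and letting \<open>t\<close> tend to 0
      bounds the component of \<open>y\<close>.\<close>
    let ?B = "\<phi> ` (D \<inter> ball u d)"
    have "openin M ?B"
      by (rule C2_chart_open_image[OF chart]) (auto simp: openin_open)
    then have "openin euclideanreal {t \<in> topspace euclideanreal. c t \<in> ?B}"
      using c(1) openin_continuous_map_preimage by blast
    then have o: "open {t. c t \<in> ?B}" by simp
    moreover have "0 \<in> {t. c t \<in> ?B}" using c(2) u d(1) by auto
    ultimately have ev: "\<forall>\<^sub>F t in at 0. c t \<in> ?B"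
      using eventually_at_topological by blast
    have lip: "\<bar>\<nu> \<bullet> (Y t - Y 0)\<bar> \<le> \<epsilon> * norm (Y t - Y 0)" if ct: "c t \<in> ?B" for t
    proof -
      obtain v where "v \<in> D" "v \<in> ball u d" "c t = \<phi> v"
        using ct by blast
      then have v: "v \<in> D" "norm (v - u) < d" "c t = \<phi> v"
        by (simp_all add: dist_norm norm_minus_commute)
      have "Y t = X v" "Y 0 = X u"
        using Y(1)[of t, symmetric] Y(1)[of 0, symmetric] v(3) c(2) by (simp_all add: X_def)
      then show ?thesis using near[OF v(2)] by simp
    qed
    have ev2: "\<forall>\<^sub>F t in at 0. \<bar>\<nu> \<bullet> ((Y t - Y 0) /\<^sub>R t)\<bar> \<le> \<epsilon> * norm ((Y t - Y 0) /\<^sub>R t)"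
    proof (rule eventually_mono[OF ev])
      fix t assume "c t \<in> ?B"
      then have "inverse \<bar>t\<bar> * \<bar>\<nu> \<bullet> (Y t - Y 0)\<bar> \<le> inverse \<bar>t\<bar> * (\<epsilon> * norm (Y t - Y 0))"
        using lip by (intro mult_left_mono) auto
      then show "\<bar>\<nu> \<bullet> ((Y t - Y 0) /\<^sub>R t)\<bar> \<le> \<epsilon> * norm ((Y t - Y 0) /\<^sub>R t)"
        by (simp add: abs_mult mult.left_commute)
    qed
    have "((\<lambda>t. norm (Y t - Y 0 - t *\<^sub>R y) / norm t) \<longlongrightarrow> 0) (at 0)"
      using Y(2) by (simp add: has_vector_derivative_def has_derivative_iff_norm)
    moreover have "\<forall>\<^sub>F t in at 0. norm (Y t - Y 0 - t *\<^sub>R y) / norm t = norm ((Y t - Y 0) /\<^sub>R t - y)"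
    proof (rule eventually_at_filter[THEN iffD2], rule always_eventually, safe)
      fix t :: real assume "t \<noteq> 0"
      then have "Y t - Y 0 - t *\<^sub>R y = t *\<^sub>R ((Y t - Y 0) /\<^sub>R t - y)"
        by (simp add: scaleR_diff_right)
      then show "norm (Y t - Y 0 - t *\<^sub>R y) / norm t = norm ((Y t - Y 0) /\<^sub>R t - y)"
        using \<open>t \<noteq> 0\<close> by (simp del: scaleR_diff_right)
    qed
    ultimately have "((\<lambda>t. norm ((Y t - Y 0) /\<^sub>R t - y)) \<longlongrightarrow> 0) (at 0)"
      by (simp add: tendsto_cong)
    then have "((\<lambda>t. (Y t - Y 0) /\<^sub>R t) \<longlongrightarrow> y) (at 0)"
      by (rule LIM_zero_cancel[OF tendsto_norm_zero_cancel])
    then show ?thesis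
      by (intro tendsto_le[OF _ _ _ ev2] tendsto_intros) auto
  qed
  show ?thesis
  proof (cases "y = 0")
    case False
    have "\<bar>\<nu> \<bullet> y\<bar> \<le> \<epsilon>" if "\<epsilon> > 0" for \<epsilon>
      using bound[of "\<epsilon> / norm y"] False that by simp
    then show ?thesis by (meson abs_le_zero_iff dense_ge)
  qed simp
qed


section \<open>First-order geometry of a rotationally symmetric surface\<close>

text \<open>Only the existence of both curvatures is taken from the Weingarten condition. It also
  brings differentiability of \<open>N\<close>, for which the definition of a surface demands only
  continuity.\<close>

locale rotational_surface =
  fixes M :: "'m topology" and F N :: "'m \<Rightarrow> real^3" and q e :: "real^3"
  assumes surface: "oriented_C2_surface M F N"
    and symmetric: "rotationally_symmetric M F q e"
    and curvatures:
      "\<And>p. p \<in> topspace M \<Longrightarrow> \<exists>k\<^sub>1. parallel_curvature M F N q e p k\<^sub>1"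
      "\<And>p. p \<in> topspace M \<Longrightarrow> \<exists>k\<^sub>2. profile_curvature M F N q e p k\<^sub>2"
begin

abbreviation \<tau> :: "'m \<Rightarrow> real^3" where "\<tau> p \<equiv> cross3 e (F p - q)"
abbreviation par where "par \<equiv> parallel_curvature M F N q e"
abbreviation prof where "prof \<equiv> profile_curvature M F N q e"

lemma norm_e: "norm e = 1"
  using symmetric by (simp add: rotationally_symmetric_def)

lemma e_e: "e \<bullet> e = 1"
  using norm_e by (simp add: dot_square_norm)

lemma norm_N: "p \<in> topspace M \<Longrightarrow> norm (N p) = 1"
  using surface by (simp add: oriented_C2_surface_def)

lemma N_N: "p \<in> topspace M \<Longrightarrow> N p \<bullet> N p = 1"
  using norm_N by (simp add: dot_square_norm)

lemma chart_exists:
  assumes "p \<in> topspace M"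
  obtains D \<phi> u where "C2_chart M F D \<phi>" "u \<in> D" "p = \<phi> u"
  using surface assms unfolding oriented_C2_surface_def by blast

text \<open>\<open>tangent_plane\<close> collects vectors from all charts at a point. All of them
  are orthogonal to \<open>N\<close>, and the range of a single chart derivative already has
  dimension two, so it fills the whole orthogonal complement.\<close>

lemma chart_tangent_plane:
  assumes chart: "C2_chart M F D \<phi>" and u: "u \<in> D"
  defines "A \<equiv> frechet_derivative (F \<circ> \<phi>) (at u)"
  shows "linear A" "inj A" "((F \<circ> \<phi>) has_derivative A) (at u)"
    and "range A = {w. N (\<phi> u) \<bullet> w = 0}" "tangent_plane M F (\<phi> u) = {w. N (\<phi> u) \<bullet> w = 0}"
proof -
  have p: "\<phi> u \<in> topspace M" using C2_chart_topspace chart u .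
  show D: "((F \<circ> \<phi>) has_derivative A) (at u)"
    using chart u unfolding C2_chart_def C2_on_def A_def
    by (metis frechet_derivative_works differentiableI)
  show lin: "linear A" using D has_derivative_linear by blast
  show inj: "inj A" using chart u by (auto simp: C2_chart_def A_def)
  have 1: "range A \<subseteq> tangent_plane M F (\<phi> u)"
    using chart u unfolding tangent_plane_def A_def by blast
  have 2: "tangent_plane M F (\<phi> u) \<subseteq> {w. N (\<phi> u) \<bullet> w = 0}"
    using surface p unfolding oriented_C2_surface_def by blast
  have "N (\<phi> u) \<noteq> 0" using norm_N[OF p] by auto
  then have "dim {w. N (\<phi> u) \<bullet> w = 0} = dim (range A)"
    using dim_hyperplane[of "N (\<phi> u)"] eucl.dim_image_eq[OF lin, of UNIV] inj
    by (simp add: dim_UNIV)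
  then show 3: "range A = {w. N (\<phi> u) \<bullet> w = 0}"
    using 1 2 lin by (intro subspace_dim_equal subspace_hyperplane linear_subspace_image) auto
  show "tangent_plane M F (\<phi> u) = {w. N (\<phi> u) \<bullet> w = 0}" using 1 2 3 by blast
qed

text \<open>The orbit of \<open>p\<close> under the action is a continuous curve in the surface
  whose image in space has velocity \<open>\<tau> p\<close> at time 0.\<close>

lemma N_orthogonal_\<tau>:
  assumes p: "p \<in> topspace M"
  shows "N p \<bullet> \<tau> p = 0"
proof -
  obtain D \<phi> u where ch: "C2_chart M F D \<phi>" "u \<in> D" "p = \<phi> u" using chart_exists[OF p] .
  obtain \<rho> where \<rho>: "continuous_map (prod_topology euclideanreal M) M (\<lambda>(t, p). \<rho> t p)"
    "\<rho> 0 p = p" "\<And>t. F (\<rho> t p) = rotate_axis q e t (F p)"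
    using symmetric p unfolding rotationally_symmetric_def by auto
  have "continuous_map euclideanreal (prod_topology euclideanreal M) (\<lambda>t. (t, p))"
    using p by (simp add: continuous_map_pairedI)
  from continuous_map_compose[OF this \<rho>(1)]
  have c: "continuous_map euclideanreal M (\<lambda>t. \<rho> t p)" by (simp add: o_def)
  have "((\<lambda>t. rotate_axis q e t (F p)) has_vector_derivative \<tau> p) (at 0)"
    unfolding rotate_axis_def
    by (rule derivative_eq_intros refl | simp)+
  moreover have "N p \<bullet> frechet_derivative (F \<circ> \<phi>) (at u) \<xi> = 0" for \<xi>
    using chart_tangent_plane(4)[OF ch(1,2)] ch(3) by auto
  ultimately show ?thesis
    using curve_velocity_orthogonal[OF ch(1,2) _ c _ \<rho>(3)] \<rho>(2) ch(3) by simp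
qed

section \<open>Derivatives of position and normal in a chart\<close>

lemma principal_curvature_derivative:
  assumes ch: "C2_chart M F D \<phi>" "u \<in> D"
    and k: "principal_curvature M F N (\<phi> u) (frechet_derivative (F \<circ> \<phi>) (at u) \<xi>) k"
  shows "(N \<circ> \<phi>) differentiable (at u)"
    "frechet_derivative (N \<circ> \<phi>) (at u) \<xi> = - k *\<^sub>R frechet_derivative (F \<circ> \<phi>) (at u) \<xi>"
  using assms unfolding principal_curvature_def has_surface_derivative_def by blast+

text \<open>\<open>N\<close> is differentiable because \<open>profile_curvature\<close> demands it
  at any nonzero profile vector, and a kernel vector provides one. The last identity is the
  derivative of \<open>N \<bullet> \<tau> = 0\<close>.\<close>

lemma chart_derivatives:
  assumes ch: "C2_chart M F D \<phi>" "u \<in> D"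
  defines "A \<equiv> frechet_derivative (F \<circ> \<phi>) (at u)"
    and "B \<equiv> frechet_derivative (N \<circ> \<phi>) (at u)"
  shows deriv_F: "((\<lambda>v. F (\<phi> v)) has_derivative A) (at u)"
    and deriv_N: "((\<lambda>v. N (\<phi> v)) has_derivative B) (at u)"
    and tangent: "\<And>\<xi>. N (\<phi> u) \<bullet> A \<xi> = 0"
    and onto_tangent: "\<And>w. N (\<phi> u) \<bullet> w = 0 \<Longrightarrow> \<exists>\<xi>. A \<xi> = w"
    and deriv_N_profile: "\<And>\<xi> k. prof (\<phi> u) k \<Longrightarrow> A \<xi> \<bullet> \<tau> (\<phi> u) = 0 \<Longrightarrow> B \<xi> = - k *\<^sub>R A \<xi>"
    and deriv_N_parallel: "\<And>\<xi> k. par (\<phi> u) k \<Longrightarrow> A \<xi> \<bullet> e = 0 \<Longrightarrow> A \<xi> \<bullet> (F (\<phi> u) - q) = 0 \<Longrightarrow>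
      B \<xi> = - k *\<^sub>R A \<xi>"
    and deriv_orthogonality: "\<And>\<xi>. B \<xi> \<bullet> \<tau> (\<phi> u) + N (\<phi> u) \<bullet> cross3 e (A \<xi>) = 0"
proof -
  note A = chart_tangent_plane[OF ch, folded A_def]
  note pc = principal_curvature_derivative[OF ch, folded A_def B_def]
  have tang: "A \<xi> \<in> tangent_plane M F (\<phi> u)" for \<xi>
    using A(4,5) by blast
  have p: "\<phi> u \<in> topspace M" using C2_chart_topspace ch .
  have "linear (\<lambda>\<xi>. A \<xi> \<bullet> \<tau> (\<phi> u))"
    using A(1) by (intro linearI) (simp_all add: linear_add linear_cmul inner_add_left)
  then obtain \<xi> where \<xi>: "norm \<xi> = 1" "A \<xi> \<bullet> \<tau> (\<phi> u) = 0"
    using exists_unit_kernel_vector by blast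
  have A0: "\<xi> = 0" if "A \<xi> = 0" for \<xi>
    using that A(1,2) by (metis linear_0 injD)
  then have "A \<xi> \<noteq> 0" using \<xi>(1) by fastforce
  then have nd: "(N \<circ> \<phi>) differentiable (at u)"
    using curvatures(2)[OF p] pc(1) tang \<xi>(2) unfolding profile_curvature_def by blast
  then have DN: "((N \<circ> \<phi>) has_derivative B) (at u)"
    unfolding B_def by (simp add: frechet_derivative_works)
  then have B0: "B 0 = 0" using has_derivative_linear linear_0 by blast
  show "((\<lambda>v. F (\<phi> v)) has_derivative A) (at u)" "((\<lambda>v. N (\<phi> v)) has_derivative B) (at u)"
    using A(3) DN by (simp_all add: o_def)
  show "N (\<phi> u) \<bullet> A \<xi> = 0" for \<xi> using A(4) by blast
  show "\<exists>\<xi>. A \<xi> = w" if "N (\<phi> u) \<bullet> w = 0" for w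
    using that A(4) by (metis (mono_tags, lifting) mem_Collect_eq rangeE)
  show "B \<xi> = - k *\<^sub>R A \<xi>" if "prof (\<phi> u) k" "A \<xi> \<bullet> \<tau> (\<phi> u) = 0" for \<xi> k
    \<comment> \<open>Principal curvatures concern nonzero vectors only; if \<open>A \<xi>\<close>
      vanishes, injectivity makes \<open>\<xi>\<close> zero and both sides vanish.\<close>
    using pc(2)[of \<xi> k] that tang[of \<xi>] A0[of \<xi>] B0 unfolding profile_curvature_def
    by (cases "A \<xi> = 0") auto
  show "B \<xi> = - k *\<^sub>R A \<xi>"
    if "par (\<phi> u) k" "A \<xi> \<bullet> e = 0" "A \<xi> \<bullet> (F (\<phi> u) - q) = 0" for \<xi> k
    using pc(2)[of \<xi> k] that tang[of \<xi>] A0[of \<xi>] B0 unfolding parallel_curvature_def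
    by (cases "A \<xi> = 0") auto
  show "B \<xi> \<bullet> \<tau> (\<phi> u) + N (\<phi> u) \<bullet> cross3 e (A \<xi>) = 0" for \<xi>
  proof -
    have "((\<lambda>v. N (\<phi> v) \<bullet> \<tau> (\<phi> v)) has_derivative
        (\<lambda>\<xi>. N (\<phi> u) \<bullet> cross3 e (A \<xi>) + B \<xi> \<bullet> \<tau> (\<phi> u))) (at u)"
      using A(3) DN unfolding o_def
      by (auto intro!: derivative_eq_intros)
    moreover have "((\<lambda>v. N (\<phi> v) \<bullet> \<tau> (\<phi> v)) has_derivative (\<lambda>\<xi>. 0)) (at u)"
    proof (rule has_derivative_transform_within_open[where f = "\<lambda>_. 0"])
      show "open D" using ch by (simp add: C2_chart_def)
      show "0 = N (\<phi> v) \<bullet> \<tau> (\<phi> v)" if "v \<in> D" for v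
        using N_orthogonal_\<tau>[OF C2_chart_topspace[OF ch(1) that]] by simp
    qed (use ch in auto)
    ultimately have "(\<lambda>\<xi>. N (\<phi> u) \<bullet> cross3 e (A \<xi>) + B \<xi> \<bullet> \<tau> (\<phi> u)) = (\<lambda>\<xi>. 0)"
      by (rule has_derivative_unique)
    then show ?thesis by (metis add.commute)
  qed
qed

lemma locally_zero_derivative:
  fixes g :: "'m \<Rightarrow> 'b::real_normed_vector"
  assumes ch: "C2_chart M F D \<phi>" "u \<in> D"
    and U: "openin M U" "\<phi> u \<in> U" "\<And>p. p \<in> U \<Longrightarrow> g p = 0"
    and L: "((\<lambda>v. g (\<phi> v)) has_derivative L) (at u)"
  shows "L \<xi> = 0"
proof -
  have "((\<lambda>v. g (\<phi> v)) has_derivative (\<lambda>\<xi>. 0)) (at u)"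
    by (rule has_derivative_transform_within_open[where f = "\<lambda>_. 0",
        OF _ C2_chart_open_vimage[OF ch(1) U(1)]]) (use ch U in auto)
  then show ?thesis using has_derivative_unique[OF L] by metis
qed

lemma zero_derivative_imp_constant:
  fixes g :: "'m \<Rightarrow> real"
  assumes con: "connected_space M"
    and g: "\<And>D \<phi> u. C2_chart M F D \<phi> \<Longrightarrow> u \<in> D \<Longrightarrow>
      ((\<lambda>v. g (\<phi> v)) has_derivative (\<lambda>\<xi>. 0)) (at u)"
    and p: "p \<in> topspace M" "p' \<in> topspace M"
  shows "g p = g p'"
proof -
  \<comment> \<open>Being equal to \<open>g p\<close> and being different from it are both used for
    \<open>P\<close>, which makes the level set of \<open>g p\<close> open and closed.\<close>
  have op: "openin M {x \<in> topspace M. P (g x)}" for P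
  proof (subst openin_subopen, safe)
    fix x assume x: "x \<in> topspace M" "P (g x)"
    obtain D \<phi> u where ch: "C2_chart M F D \<phi>" "u \<in> D" "x = \<phi> u" using chart_exists[OF x(1)] .
    have "open D" using ch by (simp add: C2_chart_def)
    then obtain d where d: "d > 0" "ball u d \<subseteq> D" using ch(2) open_contains_ball by blast
    have eq: "g (\<phi> v) = g x" if "v \<in> ball u d" for v
      unfolding ch(3)
    proof (rule has_derivative_zero_unique_connected[of "ball u d" "\<lambda>v. g (\<phi> v)"])
      show "((\<lambda>v. g (\<phi> v)) has_derivative (\<lambda>x. 0)) (at w)" if "w \<in> ball u d" for w
        using g[OF ch(1)] d(2) that by blast
    qed (use that d in auto)
    have "openin M (\<phi> ` ball u d)"
      using d(2) by (intro C2_chart_open_image[OF ch(1)]) (auto simp: openin_open)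
    moreover have "x \<in> \<phi> ` ball u d" using ch d by auto
    moreover have "\<phi> ` ball u d \<subseteq> {x \<in> topspace M. P (g x)}"
      using eq x d(2) C2_chart_topspace[OF ch(1)] by auto
    ultimately show "\<exists>T. openin M T \<and> x \<in> T \<and> T \<subseteq> {x \<in> topspace M. P (g x)}" by blast
  qed
  let ?E = "{x \<in> topspace M. g x = g p}"
  have "topspace M - ?E = {x \<in> topspace M. g x \<noteq> g p}" by auto
  then have "closedin M ?E"
    using op[of "\<lambda>y. y \<noteq> g p"] by (simp add: closedin_def)
  then have "?E = {} \<or> ?E = topspace M"
    using op[of "\<lambda>y. y = g p"] con unfolding connected_space_clopen_in by blast
  then have "p' \<in> ?E" using p by blast
  then show ?thesis by simp
qed

section \<open>Level sets of the profile curvature\<close>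

text \<open>Differentiating \<open>N \<bullet> X' \<xi> = 0\<close> for a fixed coordinate vector
  \<open>\<xi>\<close> moves the derivative from \<open>N\<close> to \<open>X'\<close>. The
  curvature is thereby expressed through quantities that are continuous in the chart.\<close>

lemma second_derivative_identity:
  assumes ch: "C2_chart M F D \<phi>"
    and X': "\<And>u. u \<in> D \<Longrightarrow> ((F \<circ> \<phi>) has_derivative blinfun_apply (X' u)) (at u)"
    and X'': "\<And>u. u \<in> D \<Longrightarrow> (X' has_derivative blinfun_apply (X'' u)) (at u)"
    and u: "u \<in> D" and k: "prof (\<phi> u) k" and \<xi>: "X' u \<xi> \<bullet> \<tau> (\<phi> u) = 0"
  shows "k * (X' u \<xi> \<bullet> X' u \<xi>) = N (\<phi> u) \<bullet> X'' u \<xi> \<xi>"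
proof -
  have eq: "blinfun_apply (X' v) = frechet_derivative (F \<circ> \<phi>) (at v)" if "v \<in> D" for v
    using X'[OF that] by (rule frechet_derivative_at)
  have DX': "((\<lambda>v. X' v \<xi>) has_derivative (\<lambda>\<eta>. X'' u \<eta> \<xi>)) (at u)"
    using X''[OF u] by (auto intro!: derivative_eq_intros)
  define B where "B = frechet_derivative (N \<circ> \<phi>) (at u)"
  from DX' have "((\<lambda>v. N (\<phi> v) \<bullet> X' v \<xi>) has_derivative
      (\<lambda>\<eta>. N (\<phi> u) \<bullet> X'' u \<eta> \<xi> + B \<eta> \<bullet> X' u \<xi>)) (at u)"
    using deriv_N[OF ch u, folded B_def] by (rule has_derivative_inner[rotated])
  moreover have "((\<lambda>v. N (\<phi> v) \<bullet> X' v \<xi>) has_derivative (\<lambda>\<eta>. 0)) (at u)"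
  proof (rule has_derivative_transform_within_open[where f = "\<lambda>_. 0"])
    show "open D" using ch by (simp add: C2_chart_def)
    show "0 = N (\<phi> v) \<bullet> X' v \<xi>" if "v \<in> D" for v
      using chart_tangent_plane(4)[OF ch that] eq[OF that] by auto
  qed (use u in auto)
  ultimately have "(\<lambda>\<eta>. N (\<phi> u) \<bullet> X'' u \<eta> \<xi> + B \<eta> \<bullet> X' u \<xi>) = (\<lambda>\<eta>. 0)"
    by (rule has_derivative_unique)
  then have "N (\<phi> u) \<bullet> X'' u \<xi> \<xi> + B \<xi> \<bullet> X' u \<xi> = 0" by metis
  then show ?thesis using deriv_N_profile[OF ch u k, of \<xi>] \<xi> eq[OF u] by (simp add: B_def)
qed

text \<open>Around a point of the axis the profile direction admits no continuous choice in general.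
  The unit vector \<open>\<xi>\<close> is therefore kept as an extra variable and projected away;
  compactness of the unit circle preserves closedness.\<close>

lemma closedin_profile_curvature: "closedin M {p \<in> topspace M. prof p k}"
proof -
  have "openin M {p \<in> topspace M. \<not> prof p k}"
  proof (subst openin_subopen, safe)
    fix p assume p: "p \<in> topspace M" "\<not> prof p k"
    obtain D \<phi> u where ch: "C2_chart M F D \<phi>" "u \<in> D" "p = \<phi> u" using chart_exists[OF p(1)] .
    obtain X' :: "real^2 \<Rightarrow> ((real^2) \<Rightarrow>\<^sub>L (real^3))" and X''
      where X': "\<And>u. u \<in> D \<Longrightarrow> ((F \<circ> \<phi>) has_derivative blinfun_apply (X' u)) (at u)"
      and X'': "\<And>u. u \<in> D \<Longrightarrow> (X' has_derivative blinfun_apply (X'' u)) (at u)"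
      and cX'': "continuous_on D X''"
      using ch(1) unfolding C2_chart_def C2_on_def by auto
    note ident = second_derivative_identity[OF ch(1) X' X'']
    have cX': "continuous_on D X'"
      using X'' by (meson continuous_at_imp_continuous_on has_derivative_continuous)
    have cX: "continuous_on D (\<lambda>u. F (\<phi> u))"
      using X' by (metis (no_types, lifting) continuous_at_imp_continuous_on has_derivative_continuous
          o_def continuous_on_cong)
    have cN: "continuous_on D (\<lambda>u. N (\<phi> u))"
    proof (intro continuous_at_imp_continuous_on ballI)
      show "isCont (\<lambda>u. N (\<phi> u)) v" if "v \<in> D" for v
        using deriv_N[OF ch(1) that] by (rule has_derivative_continuous)
    qed
    have inj: "X' v \<xi> \<noteq> 0" if "v \<in> D" "norm \<xi> = 1" for v \<xi>
    proof -
      have "inj (blinfun_apply (X' v))"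
        using chart_tangent_plane(2)[OF ch(1) that(1)] frechet_derivative_at[OF X'[OF that(1)]] by simp
      then show ?thesis using that(2) by (metis blinfun.zero_right injD norm_zero zero_neq_one)
    qed
    have ker: "\<exists>\<xi>. norm \<xi> = 1 \<and> X' v \<xi> \<bullet> \<tau> (\<phi> v) = 0" for v
      by (rule exists_unit_kernel_vector)
        (auto intro!: linearI simp: blinfun.add_right blinfun.scaleR_right inner_add_left)
    \<comment> \<open>Pairs of a chart point and a unit profile vector at which the
      second-derivative identity holds with the given \<open>k\<close>.\<close>
    let ?C = "{(v, \<xi>) \<in> D \<times> sphere 0 1. X' v \<xi> \<bullet> \<tau> (\<phi> v) = 0 \<and>
        k * (X' v \<xi> \<bullet> X' v \<xi>) - N (\<phi> v) \<bullet> X'' v \<xi> \<xi> = 0}"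
    have cont: "continuous_on (D \<times> sphere 0 1) (\<lambda>x. f (fst x))" if "continuous_on D f"
      for f :: "real^2 \<Rightarrow> 'z::topological_space"
      by (rule continuous_on_compose2[OF that]) (auto intro!: continuous_intros)
    note [continuous_intros] = cont[OF cX] cont[OF cX'] cont[OF cX''] cont[OF cN] continuous_on_cross
    have "closedin (top_of_set (D \<times> sphere 0 1))
        {x \<in> D \<times> sphere 0 1. X' (fst x) (snd x) \<bullet> \<tau> (\<phi> (fst x)) = 0}"
      by (rule continuous_closedin_preimage_constant) (intro continuous_intros)
    moreover have "closedin (top_of_set (D \<times> sphere 0 1))
        {x \<in> D \<times> sphere 0 1. k * (X' (fst x) (snd x) \<bullet> X' (fst x) (snd x))
           - N (\<phi> (fst x)) \<bullet> X'' (fst x) (snd x) (snd x) = 0}"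
      by (rule continuous_closedin_preimage_constant) (intro continuous_intros)
    ultimately have "closedin (top_of_set (D \<times> sphere 0 1)) ?C"
      by (rule closedin_Int[THEN back_subst[of "closedin _"]]) auto
    then have "closedin (top_of_set D) (fst ` ?C)"
      by (rule Starlike.closed_map_fst[rotated]) simp
    moreover have "fst ` ?C = {v \<in> D. prof (\<phi> v) k}"
    proof safe
      fix v \<xi> assume v: "v \<in> D" "\<xi> \<in> sphere (0 :: real^2) 1" "X' v \<xi> \<bullet> \<tau> (\<phi> v) = 0"
        and 0: "k * (X' v \<xi> \<bullet> X' v \<xi>) - N (\<phi> v) \<bullet> X'' v \<xi> \<xi> = 0"
      \<comment> \<open>The point has some profile curvature \<open>k'\<close>; comparing its
        identity with the one for \<open>k\<close> at the same nonzero vector forces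
        equality.\<close>
      obtain k' where k': "prof (\<phi> v) k'" using curvatures(2) C2_chart_topspace[OF ch(1) v(1)] by blast
      have "k * (X' v \<xi> \<bullet> X' v \<xi>) = k' * (X' v \<xi> \<bullet> X' v \<xi>)"
        using ident[OF _ _ v(1) k' v(3)] 0 by simp
      moreover have "X' v \<xi> \<noteq> 0" using inj[OF v(1)] v(2) by simp
      ultimately have "k = k'" by (metis inner_eq_zero_iff mult_right_cancel)
      then show "prof (\<phi> (fst (v, \<xi>))) k" using k' by simp
    next
      fix v assume v: "v \<in> D" "prof (\<phi> v) k"
      then show "v \<in> fst ` ?C"
        using ker[of v] ident[OF _ _ v(1) v(2)] by force
    qed auto
    ultimately have "openin (top_of_set D) (D - {v \<in> D. prof (\<phi> v) k})"
      by (metis (no_types, lifting) openin_diff openin_subtopology_self topspace_euclidean_subtopology)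
    then have "openin M (\<phi> ` (D - {v \<in> D. prof (\<phi> v) k}))"
      by (rule C2_chart_open_image[OF ch(1)])
    then show "\<exists>T. openin M T \<and> p \<in> T \<and> T \<subseteq> {p \<in> topspace M. \<not> prof p k}"
      using ch p C2_chart_topspace[OF ch(1)]
      by (intro exI[of _ "\<phi> ` (D - {v \<in> D. prof (\<phi> v) k})"]) auto
  qed
  moreover have "topspace M - {p \<in> topspace M. prof p k} = {p \<in> topspace M. \<not> prof p k}" by auto
  ultimately show ?thesis by (simp add: closedin_def)
qed

section \<open>Differentiating functions of position and normal\<close>

text \<open>Along a profile vector \<open>w\<close> the pair of position and normal has derivative
  \<open>(w, - k *\<^sub>R w)\<close>. Relations valid on an open set can thus be differentiated
  without returning to charts.\<close>

lemma profile_direction_derivative: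
  fixes G :: "(real^3) \<times> (real^3) \<Rightarrow> real"
  assumes U: "openin M U" "p \<in> U" "\<And>p. p \<in> U \<Longrightarrow> G (F p, N p) = 0"
    and G: "(G has_derivative G') (at (F p, N p))"
    and k: "prof p k" and w: "N p \<bullet> w = 0" "w \<bullet> \<tau> p = 0"
  shows "G' (w, - k *\<^sub>R w) = 0"
proof -
  have "p \<in> topspace M" using U(1,2) openin_subset by blast
  then obtain D \<phi> u where ch: "C2_chart M F D \<phi>" "u \<in> D" "p = \<phi> u" by (rule chart_exists)
  define A where "A = frechet_derivative (F \<circ> \<phi>) (at u)"
  define B where "B = frechet_derivative (N \<circ> \<phi>) (at u)"
  note AB = chart_derivatives[OF ch(1,2), folded A_def B_def]
  have "((\<lambda>v. G (F (\<phi> v), N (\<phi> v))) has_derivative (\<lambda>\<xi>. G' (A \<xi>, B \<xi>))) (at u)"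
    using has_derivative_compose[OF has_derivative_Pair[OF AB(1,2)]] G ch(3) by blast
  then have "G' (A \<xi>, B \<xi>) = 0" for \<xi>
    using locally_zero_derivative[OF ch(1,2) U(1), where g = "\<lambda>p. G (F p, N p)"] U(2,3) ch(3) by blast
  moreover obtain \<xi> where "A \<xi> = w" using AB(4) w(1) ch(3) by blast
  ultimately show ?thesis using AB(5)[of k \<xi>] k w(2) ch(3) by metis
qed

text \<open>Off the axis the tangent plane is spanned by \<open>\<tau> p\<close> and the profile
  direction, and both principal curvatures are known there. On the axis every tangent direction is a
  profile direction, so \<open>prof0\<close> alone suffices.\<close>

lemma constant_if_zero_derivatives:
  fixes G :: "(real^3) \<times> (real^3) \<Rightarrow> real"
  assumes con: "connected_space M"
    and G: "\<And>p. p \<in> topspace M \<Longrightarrow> (G has_derivative G' p) (at (F p, N p))"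
    and prof0: "\<And>p k w. p \<in> topspace M \<Longrightarrow> prof p k \<Longrightarrow> N p \<bullet> w = 0 \<Longrightarrow> w \<bullet> \<tau> p = 0 \<Longrightarrow>
      G' p (w, - k *\<^sub>R w) = 0"
    and par0: "\<And>p k. p \<in> topspace M \<Longrightarrow> G' p (\<tau> p, - k *\<^sub>R \<tau> p) = 0"
    and p: "p \<in> topspace M" "p' \<in> topspace M"
  shows "G (F p, N p) = G (F p', N p')"
proof (rule zero_derivative_imp_constant[OF con _ p, where g = "\<lambda>p. G (F p, N p)"])
  fix D \<phi> u assume ch: "C2_chart M F D \<phi>" "u \<in> D"
  have p: "\<phi> u \<in> topspace M" using C2_chart_topspace[OF ch] .
  define A where "A = frechet_derivative (F \<circ> \<phi>) (at u)"
  define B where "B = frechet_derivative (N \<circ> \<phi>) (at u)"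
  note AB = chart_derivatives[OF ch, folded A_def B_def]
  define L where "L = (\<lambda>\<xi>. G' (\<phi> u) (A \<xi>, B \<xi>))"
  have L: "((\<lambda>v. G (F (\<phi> v), N (\<phi> v))) has_derivative L) (at u)"
    unfolding L_def using has_derivative_compose[OF has_derivative_Pair[OF AB(1,2)]] G[OF p] by blast
  have linA: "linear A" and linL: "linear L" using AB(1) L has_derivative_linear by blast+
  obtain k\<^sub>1 k\<^sub>2 where k: "par (\<phi> u) k\<^sub>1" "prof (\<phi> u) k\<^sub>2" using curvatures[OF p] by blast
  have 1: "L \<xi> = 0" if "A \<xi> \<bullet> \<tau> (\<phi> u) = 0" for \<xi>
    using prof0[OF p k(2) AB(3) that] AB(5)[OF k(2) that] by (simp add: L_def)
  obtain \<xi>\<^sub>0 where \<xi>\<^sub>0: "A \<xi>\<^sub>0 = \<tau> (\<phi> u)" using AB(4) N_orthogonal_\<tau>[OF p] by blast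
  have "B \<xi>\<^sub>0 = - k\<^sub>1 *\<^sub>R \<tau> (\<phi> u)"
    using AB(6)[OF k(1), of \<xi>\<^sub>0] unfolding \<xi>\<^sub>0 by (simp add: dot_cross_self)
  then have 2: "L \<xi>\<^sub>0 = 0" using par0[OF p, of k\<^sub>1] \<xi>\<^sub>0 by (simp add: L_def)
  have "L \<xi> = 0" for \<xi>
  proof (cases "\<tau> (\<phi> u) = 0")
    case False
    define s where "s = (A \<xi> \<bullet> \<tau> (\<phi> u)) / (\<tau> (\<phi> u) \<bullet> \<tau> (\<phi> u))"
    have "A (\<xi> - s *\<^sub>R \<xi>\<^sub>0) \<bullet> \<tau> (\<phi> u) = 0"
      using False by (simp add: linear_diff[OF linA] linear_cmul[OF linA] \<xi>\<^sub>0 inner_diff_left s_def)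
    then show ?thesis using 1[of "\<xi> - s *\<^sub>R \<xi>\<^sub>0"] 2
      by (simp add: linear_diff[OF linL] linear_cmul[OF linL])
  qed (simp add: 1)
  then have "L = (\<lambda>\<xi>. 0)" by blast
  then show "((\<lambda>v. G (F (\<phi> v), N (\<phi> v))) has_derivative (\<lambda>\<xi>. 0)) (at u)" using L by simp
qed

section \<open>Points of the axis and the parallel curvature\<close>

lemma continuous_map_F: "continuous_map M euclidean F"
  unfolding continuous_map_def
proof (intro conjI allI impI)
  fix W :: "(real^3) set" assume W: "openin euclidean W"
  show "openin M {p \<in> topspace M. F p \<in> W}"
  proof (subst openin_subopen, safe)
    fix p assume p: "p \<in> topspace M" "F p \<in> W"
    obtain D \<phi> u where ch: "C2_chart M F D \<phi>" "u \<in> D" "p = \<phi> u" using chart_exists[OF p(1)] .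
    have "continuous_on D (F \<circ> \<phi>)"
      by (meson chart_tangent_plane(3)[OF ch(1)] continuous_at_imp_continuous_on has_derivative_continuous)
    then have "openin (top_of_set D) (D \<inter> (F \<circ> \<phi>) -` W)"
      using W by (simp add: continuous_openin_preimage_gen)
    then have "openin M (\<phi> ` (D \<inter> (F \<circ> \<phi>) -` W))" by (rule C2_chart_open_image[OF ch(1)])
    then show "\<exists>T. openin M T \<and> p \<in> T \<and> T \<subseteq> {p \<in> topspace M. F p \<in> W}"
      using ch p C2_chart_topspace[OF ch(1)]
      by (intro exI[of _ "\<phi> ` (D \<inter> (F \<circ> \<phi>) -` W)"]) auto
  qed
qed auto

lemma openin_F_vimage: "open {x. P x} \<Longrightarrow> openin M {p \<in> topspace M. P (F p)}"
  using openin_continuous_map_preimage[OF continuous_map_F, of "{x. P x}"] by simp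

text \<open>Where \<open>\<tau>\<close> vanishes, the derivative of
  \<open>N \<bullet> \<tau> = 0\<close> says that \<open>N \<bullet> cross3 e w = 0\<close> for
  every tangent \<open>w\<close>. Taking \<open>w = cross3 (N p) e\<close> gives
  \<open>(N p \<bullet> e)\<^sup>2 = 1\<close>.\<close>

lemma N_parallel_axis:
  assumes p: "p \<in> topspace M" and ax: "\<tau> p = 0"
  shows "N p = (e \<bullet> N p) *\<^sub>R e"
proof -
  obtain D \<phi> u where ch: "C2_chart M F D \<phi>" "u \<in> D" "p = \<phi> u" using chart_exists[OF p] .
  define A where "A = frechet_derivative (F \<circ> \<phi>) (at u)"
  define B where "B = frechet_derivative (N \<circ> \<phi>) (at u)"
  note AB = chart_derivatives[OF ch(1,2), folded A_def B_def]
  have "N p \<bullet> cross3 e (cross3 (N p) e) = 0"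
  proof -
    obtain \<xi> where "A \<xi> = cross3 (N p) e"
      using AB(4)[of "cross3 (N p) e"] ch(3) by (auto simp: dot_cross_self)
    then show ?thesis using AB(7)[of \<xi>] ax ch(3) by simp
  qed
  then have "(N p \<bullet> e)\<^sup>2 = 1"
    using N_N[OF p] e_e by (simp add: Lagrange inner_diff_right inner_commute power2_eq_square)
  then have "(norm (cross3 e (N p)))\<^sup>2 = 0"
    using norm_cross[of e "N p"] norm_N[OF p] norm_e by (simp add: inner_commute)
  then have "cross3 e (cross3 e (N p)) = 0" by simp
  then show ?thesis using e_e by (simp add: Lagrange)
qed

lemma profile_vector_exists:
  assumes p: "p \<in> topspace M"
  obtains w where "w \<noteq> 0" "w \<in> tangent_plane M F p" "N p \<bullet> w = 0" "w \<bullet> \<tau> p = 0"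
proof -
  obtain D \<phi> u where ch: "C2_chart M F D \<phi>" "u \<in> D" "p = \<phi> u" using chart_exists[OF p] .
  define A where "A = frechet_derivative (F \<circ> \<phi>) (at u)"
  note A = chart_tangent_plane[OF ch(1,2), folded A_def]
  have "linear (\<lambda>\<xi>. A \<xi> \<bullet> \<tau> p)"
    using A(1) by (intro linearI) (simp_all add: linear_add linear_cmul inner_add_left)
  then obtain \<xi> where \<xi>: "norm \<xi> = 1" "A \<xi> \<bullet> \<tau> p = 0"
    using exists_unit_kernel_vector by blast
  have "A \<xi> \<noteq> 0" using \<xi>(1) A(1,2) by (metis linear_0 injD norm_zero zero_neq_one)
  moreover have "A \<xi> \<in> range A" by simp
  ultimately show ?thesis using that[of "A \<xi>"] \<xi>(2) A(4,5) ch(3) by auto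
qed

lemma principal_curvature_unique:
  assumes p: "p \<in> topspace M"
    and k: "principal_curvature M F N p w k" "principal_curvature M F N p w k'"
  shows "k = k'"
proof -
  have w: "w \<noteq> 0" "w \<in> tangent_plane M F p"
    using k unfolding principal_curvature_def has_surface_derivative_def by auto
  then obtain D \<phi> u \<xi> where ch: "C2_chart M F D \<phi>" "u \<in> D" "\<phi> u = p"
      "w = frechet_derivative (F \<circ> \<phi>) (at u) \<xi>"
    unfolding tangent_plane_def by blast
  have "- k *\<^sub>R w = - k' *\<^sub>R w"
    using principal_curvature_derivative(2)[OF ch(1,2)] k ch(3,4) by metis
  then show ?thesis using w(1) by simp
qed

lemma profile_curvature_unique:
  assumes "p \<in> topspace M" "prof p k" "prof p k'"
  shows "k = k'"
  using profile_vector_exists[OF assms(1)] principal_curvature_unique[OF assms(1)] assms(2,3)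
  unfolding profile_curvature_def by metis

text \<open>Both \<open>N p\<close> and \<open>F p - q\<close> are multiples of \<open>e\<close>
  here, so a profile vector also qualifies as a parallel one and carries both eigenvalues.\<close>

lemma umbilic_at_axis:
  assumes p: "p \<in> topspace M" and ax: "\<tau> p = 0" and k: "par p k\<^sub>1" "prof p k\<^sub>2"
  shows "k\<^sub>1 = k\<^sub>2"
proof -
  obtain w where w: "w \<noteq> 0" "w \<in> tangent_plane M F p" "N p \<bullet> w = 0" "w \<bullet> \<tau> p = 0"
    using profile_vector_exists[OF p] .
  have N: "N p = (e \<bullet> N p) *\<^sub>R e" using N_parallel_axis[OF p ax] .
  then have "e \<bullet> N p \<noteq> 0" using norm_N[OF p] by auto
  then have we: "w \<bullet> e = 0" using w(3) N by (metis inner_commute inner_scaleR_left mult_eq_0_iff)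
  have "cross3 e (\<tau> p) = 0" using ax by simp
  then have "F p - q = (e \<bullet> (F p - q)) *\<^sub>R e" using e_e by (simp add: Lagrange)
  then have "w \<bullet> (F p - q) = 0" using we by (metis inner_scaleR_right mult_zero_right)
  then show ?thesis
    using principal_curvature_unique[OF p] k w we
    unfolding parallel_curvature_def profile_curvature_def by metis
qed

text \<open>This is the derivative of \<open>N \<bullet> \<tau> = 0\<close> along the parallel
  itself, where the normal changes by \<open>- k *\<^sub>R \<tau> p\<close>.\<close>

lemma parallel_curvature_identity:
  assumes p: "p \<in> topspace M" and k: "par p k"
  shows "k * (\<tau> p \<bullet> \<tau> p) = N p \<bullet> cross3 e (\<tau> p)"
proof -
  obtain D \<phi> u where ch: "C2_chart M F D \<phi>" "u \<in> D" "p = \<phi> u" using chart_exists[OF p] .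
  define A where "A = frechet_derivative (F \<circ> \<phi>) (at u)"
  define B where "B = frechet_derivative (N \<circ> \<phi>) (at u)"
  note AB = chart_derivatives[OF ch(1,2), folded A_def B_def]
  obtain \<xi> where \<xi>: "A \<xi> = \<tau> p" using AB(4) N_orthogonal_\<tau>[OF p] ch(3) by blast
  then have "B \<xi> = - k *\<^sub>R \<tau> p" using AB(6)[of k \<xi>] k ch(3) by (simp add: dot_cross_self)
  then show ?thesis using AB(7)[of \<xi>] \<xi> ch(3) by simp
qed


section \<open>Constancy of the profile curvature\<close>

lemma profile_flat_if_parallel_curvature_constant:
  assumes U: "openin M U" and a: "\<And>p. p \<in> U \<Longrightarrow> par p a \<and> \<not> prof p a \<and> \<tau> p \<noteq> 0"
    and p: "p \<in> U" and k: "prof p k"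
  shows "k = 0"
proof -
  have M: "p \<in> topspace M" if "p \<in> U" for p using that U openin_subset by blast
  have h: "a * (\<tau> p \<bullet> \<tau> p) = N p \<bullet> cross3 e (\<tau> p)" if "p \<in> U" for p
    using parallel_curvature_identity M a that by blast
  \<comment> \<open>This vector is tangent and orthogonal to \<open>\<tau> p\<close>, hence a
    profile direction.\<close>
  define w where "w p = cross3 (N p) (\<tau> p)" for p
  have we: "w p \<bullet> e = - (N p \<bullet> cross3 e (\<tau> p))" for p
    unfolding w_def by (simp add: cross3_simps)
  have wN: "N p \<bullet> w p = 0" "w p \<bullet> \<tau> p = 0" for p
    by (simp_all add: w_def dot_cross_self)
  have Ne: "N p \<bullet> e = 0" if p: "p \<in> U" for p
  proof -
    obtain k where k: "prof p k" "k \<noteq> a" using curvatures(2) M a p by metis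
    let ?T = "\<lambda>x. cross3 e (x - q)"
    define G :: "(real^3) \<times> (real^3) \<Rightarrow> real"
      where "G = (\<lambda>z. a * (?T (fst z) \<bullet> ?T (fst z)) - snd z \<bullet> cross3 e (?T (fst z)))"
    define G' :: "(real^3) \<times> (real^3) \<Rightarrow> real"
      where "G' = (\<lambda>z. 2 * a * (\<tau> p \<bullet> cross3 e (fst z)) - snd z \<bullet> cross3 e (\<tau> p)
        - N p \<bullet> cross3 e (cross3 e (fst z)))"
    have "(G has_derivative G') (at (F p, N p))"
      unfolding G_def G'_def
      by (rule derivative_eq_intros refl)+ (auto simp: fun_eq_iff inner_commute algebra_simps)
    from profile_direction_derivative[OF U p _ this k(1) wN]
    have "G' (w p, - k *\<^sub>R w p) = 0" using h by (simp add: G_def)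
    then have *: "2 * a * (\<tau> p \<bullet> cross3 e (w p)) + k * (w p \<bullet> cross3 e (\<tau> p))
        - N p \<bullet> cross3 e (cross3 e (w p)) = 0" by (simp add: G'_def)
    have 1: "w p \<bullet> cross3 e (\<tau> p) = (N p \<bullet> e) * (\<tau> p \<bullet> \<tau> p)"
      using N_orthogonal_\<tau>[OF M[OF p]] unfolding w_def dot_cross by simp
    have 2: "\<tau> p \<bullet> cross3 e (w p) = - (w p \<bullet> cross3 e (\<tau> p))"
      by (simp add: cross3_simps)
    have 3: "N p \<bullet> cross3 e (cross3 e (w p)) = - a * (\<tau> p \<bullet> \<tau> p) * (N p \<bullet> e)"
      using we[of p] h[OF p] wN(1)[of p] e_e
      by (simp add: Lagrange inner_diff_right inner_commute)
    \<comment> \<open>The three terms of \<open>*\<close> contribute \<open>- 2 * a\<close>,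
      \<open>k\<close> and \<open>a\<close> times the common factor
      \<open>(\<tau> p \<bullet> \<tau> p) * (N p \<bullet> e)\<close>.\<close>
    have "(k - a) * (\<tau> p \<bullet> \<tau> p) * (N p \<bullet> e) = 0"
      using * unfolding 2 1 3 by (simp add: algebra_simps)
    then show ?thesis using k(2) a[OF p] by simp
  qed
  \<comment> \<open>Since \<open>N \<bullet> e = 0\<close> now holds on all of \<open>U\<close>, it
    may be differentiated along the profile in its turn.\<close>
  have "((\<lambda>z. snd z \<bullet> e) has_derivative (\<lambda>z. snd z \<bullet> e)) (at (F p, N p))"
    by (rule derivative_eq_intros refl)+ auto
  from profile_direction_derivative[OF U p _ this k wN]
  have "k * (w p \<bullet> e) = 0" using Ne by simp
  \<comment> \<open>Otherwise \<open>N p\<close> would be orthogonal to the three frame vectors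
    \<open>e\<close>, \<open>\<tau> p\<close> and \<open>cross3 e (\<tau> p)\<close>.\<close>
  moreover have "w p \<bullet> e \<noteq> 0"
  proof
    assume "w p \<bullet> e = 0"
    then have "N p \<bullet> cross3 e (\<tau> p) = 0" using we by simp
    moreover have "cross3 e (\<tau> p) \<noteq> 0"
      using cross3_unit_orthogonal[OF norm_e, of "\<tau> p"] a[OF p] by (metis dot_cross_self(1) inner_commute norm_eq_zero)
    ultimately have "N p = 0"
      using eq_zero_if_orthogonal[of "N p" e "\<tau> p"] Ne[OF p] N_orthogonal_\<tau>[OF M[OF p]] by blast
    then show False using norm_N[OF M[OF p]] by simp
  qed
  ultimately show ?thesis by simp
qed

lemma profile_curvature_constant:
  assumes con: "connected_space M"
    and ab: "\<And>p. p \<in> topspace M \<Longrightarrow> \<exists>k\<^sub>1 k\<^sub>2. par p k\<^sub>1 \<and> prof p k\<^sub>2 \<and> (k\<^sub>1 = a \<or> k\<^sub>2 = b)"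
  obtains c where "\<And>p. p \<in> topspace M \<Longrightarrow> prof p c"
proof -
  have three: "k = 0 \<or> k = a \<or> k = b" if p: "p \<in> topspace M" and k: "prof p k" for p k
  proof (rule ccontr)
    assume neg: "\<not> (k = 0 \<or> k = a \<or> k = b)"
    \<comment> \<open>An open set on which the parallel curvature must be \<open>a\<close>, since
      the alternative \<open>b\<close> for the profile curvature is excluded.\<close>
    let ?U = "{p \<in> topspace M. \<not> prof p a} \<inter> {p \<in> topspace M. \<not> prof p b} \<inter> {p \<in> topspace M. \<tau> p \<noteq> 0}"
    have o: "openin M {p \<in> topspace M. \<not> prof p c}" for c
      using closedin_profile_curvature[of c]
      by (simp add: closedin_def set_diff_eq) (metis (no_types, lifting) Collect_cong)
    have "continuous_on UNIV (\<lambda>x. cross3 e (x - q))"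
      by (intro continuous_intros continuous_on_cross)
    then have "open {x. cross3 e (x - q) \<noteq> 0}"
      by (intro open_Collect_neq continuous_on_const)
    then have U: "openin M ?U" using o openin_F_vimage by (intro openin_Int) auto
    have par: "par p' a" if "p' \<in> topspace M" "\<not> prof p' b" for p' using ab that by blast
    have nk: "\<not> prof p a" "\<not> prof p b" using neg profile_curvature_unique[OF p k] by blast+
    \<comment> \<open>A point of the axis is umbilic, so its profile curvature would equal
      \<open>a\<close>.\<close>
    moreover have "\<tau> p \<noteq> 0"
      using umbilic_at_axis[OF p _ par[OF p nk(2)] k] neg by blast
    ultimately have "p \<in> ?U" using p by blast
    then have "k = 0"
      using profile_flat_if_parallel_curvature_constant[OF U _ _ k, of a] par by blast
    then show False using neg by blast
  qed
  show ?thesis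
  proof (cases "topspace M = {}")
    case False
    then obtain p\<^sub>0 c where p\<^sub>0: "p\<^sub>0 \<in> topspace M" "prof p\<^sub>0 c" using curvatures by blast
    let ?K = "\<lambda>c. {p \<in> topspace M. prof p c}"
    \<comment> \<open>The complement of the level set of \<open>c\<close> is a finite union of
      closed level sets, so that level set is open as well as closed.\<close>
    have "closedin M (\<Union>k \<in> {0, a, b} - {c}. ?K k)"
      using closedin_profile_curvature by (intro closedin_Union) auto
    moreover have "(\<Union>k \<in> {0, a, b} - {c}. ?K k) = topspace M - ?K c"
    proof (intro equalityI subsetI)
      fix p assume p: "p \<in> topspace M - ?K c"
      obtain k where "prof p k" using curvatures p by blast
      then show "p \<in> (\<Union>k \<in> {0, a, b} - {c}. ?K k)" using three[of p k] p by blast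
    qed (use profile_curvature_unique in blast)
    ultimately have "openin M (?K c)"
      by (simp add: openin_closedin)
    then have "?K c = topspace M"
      using con closedin_profile_curvature[of c] p\<^sub>0 unfolding connected_space_clopen_in by blast
    then show ?thesis using that[of c] by blast
  qed (use that in blast)
qed

end


section \<open>Classification\<close>

text \<open>Equality of the norms puts the coordinates of \<open>b\<close> with respect to
  \<open>a\<close> and \<open>cross3 e a\<close> on the unit circle.\<close>

lemma exists_rotation_angle:
  fixes e a b :: "real^3"
  assumes e: "norm e = 1" and a: "a \<bullet> e = 0" and b: "b \<bullet> e = 0" and ab: "norm a = norm b"
  shows "\<exists>t. b = cos t *\<^sub>R a + sin t *\<^sub>R cross3 e a"
proof (cases "a = 0")
  case False
  define x y where "x = (b \<bullet> a) / (a \<bullet> a)" and "y = (b \<bullet> cross3 e a) / (a \<bullet> a)"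
  have b': "b = x *\<^sub>R a + y *\<^sub>R cross3 e a"
    using orthogonal_frame_expansion[OF e a False, of b] b by (simp add: x_def y_def)
  have cc: "cross3 e a \<bullet> cross3 e a = a \<bullet> a"
    using cross3_unit_orthogonal[OF e a] by (simp add: dot_square_norm)
  have "a \<bullet> a = b \<bullet> b" using ab by (simp add: dot_square_norm)
  also have "\<dots> = (x\<^sup>2 + y\<^sup>2) * (a \<bullet> a)"
    by (subst (1 2) b') (simp add: inner_add_left inner_add_right cc dot_cross_self
        power2_eq_square algebra_simps)
  finally have "x\<^sup>2 + y\<^sup>2 = 1" using False by simp
  then obtain t where "x = cos t" "y = sin t" using sincos_total_2pi by blast
  then show ?thesis using b' by blast
qed (use ab in auto)

context rotational_surface
begin

section \<open>Nonzero profile curvature: tori and spheres\<close>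

lemma torus_or_sphere_if_profile_curvature:
  assumes con: "connected_space M" and c: "c \<noteq> 0"
    and prof: "\<And>p. p \<in> topspace M \<Longrightarrow> prof p c"
  shows "\<exists>T. (torus_of_revolution T \<or> round_sphere T) \<and> F ` topspace M \<subseteq> T"
proof (cases "topspace M = {}")
  case True
  have "round_sphere (sphere 0 1)" unfolding round_sphere_def using zero_less_one by blast
  then show ?thesis using True by auto
next
  case False
  then obtain p\<^sub>0 where p\<^sub>0: "p\<^sub>0 \<in> topspace M" by blast
  \<comment> \<open>The centre of curvature of the profile curve, relative to
    \<open>q\<close>.\<close>
  define C where "C p = F p + (1 / c) *\<^sub>R N p - q" for p
  define h where "h = C p\<^sub>0 \<bullet> e"
  have k_eq: "k = c" if "p \<in> topspace M" "prof p k" for p k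
    using profile_curvature_unique that prof by blast
  have yT: "(F p - q) \<bullet> \<tau> p = 0" "e \<bullet> \<tau> p = 0" for p by (simp_all add: dot_cross_self)
  \<comment> \<open>Along profiles the centre is stationary. Along parallels it moves by a multiple
    of \<open>\<tau> p\<close>, which is orthogonal to \<open>e\<close> and to \<open>C p\<close>;
    this serves both the height and the distance from \<open>q\<close>.\<close>
  have height: "C p \<bullet> e = h" if p: "p \<in> topspace M" for p
  proof -
    define G :: "(real^3) \<times> (real^3) \<Rightarrow> real"
      where "G = (\<lambda>z. (fst z + (1 / c) *\<^sub>R snd z - q) \<bullet> e)"
    have "G (F p, N p) = G (F p\<^sub>0, N p\<^sub>0)"
    proof (rule constant_if_zero_derivatives[OF con _ _ _ p p\<^sub>0])
      show "(G has_derivative (\<lambda>z. (fst z + (1 / c) *\<^sub>R snd z) \<bullet> e)) (at (F p, N p))" for p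
        unfolding G_def by (rule derivative_eq_intros refl)+ auto
    qed (use k_eq c yT(2) in \<open>auto simp: inner_diff_left inner_diff_right inner_commute\<close>)
    then show ?thesis by (simp add: G_def C_def h_def)
  qed
  have dist: "C p \<bullet> C p = C p\<^sub>0 \<bullet> C p\<^sub>0" if p: "p \<in> topspace M" for p
  proof -
    define G :: "(real^3) \<times> (real^3) \<Rightarrow> real"
      where "G = (\<lambda>z. (fst z + (1 / c) *\<^sub>R snd z - q) \<bullet> (fst z + (1 / c) *\<^sub>R snd z - q))"
    have "G (F p, N p) = G (F p\<^sub>0, N p\<^sub>0)"
    proof (rule constant_if_zero_derivatives[OF con _ _ _ p p\<^sub>0])
      show "(G has_derivative (\<lambda>z. 2 * (C p \<bullet> (fst z + (1 / c) *\<^sub>R snd z)))) (at (F p, N p))" for p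
        unfolding G_def C_def
        by (rule derivative_eq_intros refl)+ (auto simp: fun_eq_iff inner_commute)
    next
      fix p k assume p: "p \<in> topspace M"
      have "C p \<bullet> \<tau> p = 0"
        using yT(1)[of p] N_orthogonal_\<tau>[OF p]
        by (simp add: C_def inner_diff_left inner_add_left)
      then show "2 * (C p \<bullet> (fst (\<tau> p, - k *\<^sub>R \<tau> p) + (1 / c) *\<^sub>R snd (\<tau> p, - k *\<^sub>R \<tau> p))) = 0"
        by (simp add: inner_diff_right)
    qed (use k_eq c in auto)
    then show ?thesis by (simp add: G_def C_def)
  qed
  \<comment> \<open>The part of the centre orthogonal to the axis; constant height and distance
    confine it to a circle about the axis.\<close>
  define D where "D p = C p - h *\<^sub>R e" for p
  have De: "D p \<bullet> e = 0" if "p \<in> topspace M" for p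
    using height[OF that] e_e by (simp add: D_def inner_diff_left)
  have DD: "D p \<bullet> D p = D p\<^sub>0 \<bullet> D p\<^sub>0" if p: "p \<in> topspace M" for p
    using dist[OF p] height[OF p] height[OF p\<^sub>0]
    by (simp add: D_def inner_diff_left inner_diff_right inner_commute)
  then have nD: "norm (D p) = norm (D p\<^sub>0)" if "p \<in> topspace M" for p
    using that by (simp add: norm_eq_sqrt_inner)
  have FC: "F p - (q + h *\<^sub>R e + D p) = - (1 / c) *\<^sub>R N p" for p
    by (simp add: D_def C_def)
  have radius: "dist (q + h *\<^sub>R e + D p) (F p) = 1 / \<bar>c\<bar>" if p: "p \<in> topspace M" for p
    using norm_N[OF p] by (subst dist_commute) (simp add: dist_norm FC)
  show ?thesis
  \<comment> \<open>If this circle has radius zero, all centres coincide in one point of the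
    axis.\<close>
  proof (cases "D p\<^sub>0 = 0")
    case True
    then have "D p = 0" if "p \<in> topspace M" for p using nD[OF that] by simp
    then have "F ` topspace M \<subseteq> sphere (q + h *\<^sub>R e) (1 / \<bar>c\<bar>)" using radius by fastforce
    moreover have "round_sphere (sphere (q + h *\<^sub>R e) (1 / \<bar>c\<bar>))"
      unfolding round_sphere_def using c by (metis zero_less_abs_iff zero_less_divide_1_iff)
    ultimately show ?thesis by blast
  next
    case False
    \<comment> \<open>Unit normal of the plane through the axis and the reference centre; the
      generating circle is taken in this plane.\<close>
    define n where "n = (1 / norm (D p\<^sub>0)) *\<^sub>R cross3 e (D p\<^sub>0)"
    define c\<^sub>0 where "c\<^sub>0 = q + h *\<^sub>R e + D p\<^sub>0"
    define T where "T = (\<Union>t. rotate_axis q e t ` (sphere c\<^sub>0 (1 / \<bar>c\<bar>) \<inter> {x. n \<bullet> (x - q) = 0}))"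
    have "norm n = 1"
      using False cross3_unit_orthogonal[OF norm_e De[OF p\<^sub>0]] by (simp add: n_def)
    moreover have ne: "n \<bullet> e = 0" and nd: "n \<bullet> D p\<^sub>0 = 0"
      by (simp_all add: n_def dot_cross_self)
    moreover have "n \<bullet> (c\<^sub>0 - q) = 0"
      using ne nd by (simp add: c\<^sub>0_def inner_add_right)
    ultimately have "torus_of_revolution T"
      unfolding torus_of_revolution_def T_def using norm_e c
      by (intro exI[of _ q] exI[of _ e] exI[of _ n] exI[of _ c\<^sub>0] exI[of _ "1 / \<bar>c\<bar>"]) simp
    moreover have "F p \<in> T" if p: "p \<in> topspace M" for p
    proof -
      obtain t where t: "D p = cos t *\<^sub>R D p\<^sub>0 + sin t *\<^sub>R cross3 e (D p\<^sub>0)"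
        using exists_rotation_angle[OF norm_e De[OF p\<^sub>0] De[OF p] nD[OF p, symmetric]] by blast
      have D0: "D p \<noteq> 0" using nD[OF p] False by auto
      have y: "F p - q = h *\<^sub>R e + D p - (1 / c) *\<^sub>R N p" by (simp add: D_def C_def)
      \<comment> \<open>The aim is that \<open>F p\<close> lies in the plane through the axis and
        its own centre of curvature, so that \<open>e\<close> and \<open>D p\<close> suffice to
        express it.\<close>
      have "cross3 e (D p) = \<tau> p + (1 / c) *\<^sub>R cross3 e (N p)"
        by (simp add: y cross_add_right Cross3.right_diff_distrib cross_mult_right)
      then have "(F p - q) \<bullet> cross3 e (D p) = (1 / c) * ((F p - q) \<bullet> cross3 e (N p))"
        by (simp only: inner_add_right yT(1) inner_scaleR_right)
      also have "(F p - q) \<bullet> cross3 e (N p) = - (N p \<bullet> \<tau> p)"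
        by (simp add: cross3_simps)
      finally have "(F p - q) \<bullet> cross3 e (D p) = 0" using N_orthogonal_\<tau>[OF p] by simp
      then obtain z s where zs: "F p - q = z *\<^sub>R e + s *\<^sub>R D p"
        using orthogonal_frame_expansion[OF norm_e De[OF p] D0, of "F p - q"] by auto
      \<comment> \<open>\<open>F p\<close> turned back into the reference plane: \<open>D p\<close>
        is replaced by \<open>D p\<^sub>0\<close>. Distances survive because both are orthogonal to
        \<open>e\<close> and have the same norm.\<close>
      define x where "x = q + z *\<^sub>R e + s *\<^sub>R D p\<^sub>0"
      have "(norm (x - c\<^sub>0))\<^sup>2 = (norm (F p - (q + h *\<^sub>R e + D p)))\<^sup>2"
      proof -
        have 1: "x - c\<^sub>0 = (z - h) *\<^sub>R e + (s - 1) *\<^sub>R D p\<^sub>0"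
          by (simp add: x_def c\<^sub>0_def algebra_simps)
        have 2: "F p - (q + h *\<^sub>R e + D p) = (z - h) *\<^sub>R e + (s - 1) *\<^sub>R D p"
          using zs by (simp add: algebra_simps)
        have "(norm ((z - h) *\<^sub>R e + (s - 1) *\<^sub>R D p'))\<^sup>2 = (z - h)\<^sup>2 + (s - 1)\<^sup>2 * (norm (D p\<^sub>0))\<^sup>2"
          if "p' \<in> topspace M" for p'
          unfolding power2_norm_eq_inner using De[OF that] DD[OF that] e_e
          by (simp add: inner_add_left inner_add_right inner_commute power2_eq_square)
        then show ?thesis unfolding 1 2 using p p\<^sub>0 by metis
      qed
      then have "x \<in> sphere c\<^sub>0 (1 / \<bar>c\<bar>)"
        using radius[OF p] by (simp add: dist_norm norm_minus_commute)
      moreover have "n \<bullet> (x - q) = 0" using ne nd by (simp add: x_def inner_add_right)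
      moreover have "rotate_axis q e t x = F p"
      proof -
        have Fp: "F p = q + z *\<^sub>R e + s *\<^sub>R (cos t *\<^sub>R D p\<^sub>0 + sin t *\<^sub>R cross3 e (D p\<^sub>0))"
          using zs t by (simp add: algebra_simps)
        have xq: "x - q = z *\<^sub>R e + s *\<^sub>R D p\<^sub>0" by (simp add: x_def)
        have "e \<bullet> (x - q) = z" "cross3 e (x - q) = s *\<^sub>R cross3 e (D p\<^sub>0)"
          using De[OF p\<^sub>0] e_e unfolding xq
          by (simp_all add: inner_add_right inner_commute cross_add_right cross_mult_right)
        then have "rotate_axis q e t x = q + cos t *\<^sub>R (z *\<^sub>R e + s *\<^sub>R D p\<^sub>0)
            + sin t *\<^sub>R s *\<^sub>R cross3 e (D p\<^sub>0) + ((1 - cos t) * z) *\<^sub>R e"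
          by (simp only: rotate_axis_def xq[symmetric])
        also have "\<dots> = F p"
        proof -
          have "((1 - cos t) * z) *\<^sub>R e = z *\<^sub>R e - (cos t * z) *\<^sub>R e"
            by (simp only: left_diff_distrib scaleR_diff_left mult_1)
          then show ?thesis unfolding Fp
            by (simp add: scaleR_add_right mult.commute)
        qed
        finally show ?thesis .
      qed
      ultimately have "F p \<in> rotate_axis q e t ` (sphere c\<^sub>0 (1 / \<bar>c\<bar>) \<inter> {x. n \<bullet> (x - q) = 0})"
        by (intro image_eqI[of _ _ x]) auto
      then show ?thesis unfolding T_def by (rule UN_I[OF UNIV_I])
    qed
    ultimately show ?thesis by blast
  qed
qed

section \<open>Zero profile curvature: planes, cones and cylinders\<close>

lemma plane_cone_or_cylinder_if_profile_flat:
  assumes con: "connected_space M" and prof: "\<And>p. p \<in> topspace M \<Longrightarrow> prof p 0"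
  shows "\<exists>T. (plane T \<or> circular_cone T \<or> cylinder T) \<and> F ` topspace M \<subseteq> T"
proof (cases "topspace M = {}")
  case True
  have "plane {x. e \<bullet> (x - q) = 0}"
    unfolding plane_def using e_e by (metis inner_zero_left zero_neq_one)
  then show ?thesis using True by auto
next
  case False
  then obtain p\<^sub>0 where p\<^sub>0: "p\<^sub>0 \<in> topspace M" by blast
  define \<nu> where "\<nu> = N p\<^sub>0 \<bullet> e"
  define h where "h = N p\<^sub>0 \<bullet> (F p\<^sub>0 - q)"
  have k_eq: "k = 0" if "p \<in> topspace M" "prof p k" for p k
    using profile_curvature_unique that prof by blast
  have yT: "(F p - q) \<bullet> \<tau> p = 0" "\<tau> p \<bullet> (F p - q) = 0" "\<tau> p \<bullet> e = 0" for p
    by (simp_all add: dot_cross_self)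
  \<comment> \<open>The normal is stationary along profiles and changes by a multiple of
    \<open>\<tau> p\<close> along parallels. As \<open>\<tau> p\<close> is orthogonal to
    \<open>e\<close> and to \<open>F p - q\<close>, both this product and the next one are
    constant.\<close>
  have Ne: "N p \<bullet> e = \<nu>" if p: "p \<in> topspace M" for p
  proof -
    have "snd (F p, N p) \<bullet> e = snd (F p\<^sub>0, N p\<^sub>0) \<bullet> e"
    proof (rule constant_if_zero_derivatives[OF con _ _ _ p p\<^sub>0])
      show "((\<lambda>z. snd z \<bullet> e) has_derivative (\<lambda>z. snd z \<bullet> e)) (at (F p, N p))" for p
        by (rule derivative_eq_intros refl)+ auto
    qed (use k_eq yT in auto)
    then show ?thesis by (simp add: \<nu>_def)
  qed
  have Ny: "N p \<bullet> (F p - q) = h" if p: "p \<in> topspace M" for p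
  proof -
    define G :: "(real^3) \<times> (real^3) \<Rightarrow> real" where "G = (\<lambda>z. snd z \<bullet> (fst z - q))"
    have "G (F p, N p) = G (F p\<^sub>0, N p\<^sub>0)"
    proof (rule constant_if_zero_derivatives[OF con _ _ _ p p\<^sub>0])
      show "(G has_derivative (\<lambda>z. N p \<bullet> fst z + snd z \<bullet> (F p - q))) (at (F p, N p))" for p
        unfolding G_def by (rule derivative_eq_intros refl)+ auto
    qed (use k_eq yT N_orthogonal_\<tau> in auto)
    then show ?thesis by (simp add: G_def h_def)
  qed
  define r z where "r p = norm (\<tau> p)" and "z p = (F p - q) \<bullet> e" for p
  have r2: "(r p)\<^sup>2 = (F p - q) \<bullet> (F p - q) - (z p)\<^sup>2" for p
    using norm_cross[of e "F p - q"] norm_e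
    by (simp add: r_def z_def dot_square_norm inner_commute)
  have eN: "(norm (cross3 e (N p)))\<^sup>2 = 1 - \<nu>\<^sup>2" if "p \<in> topspace M" for p
    using norm_cross[of e "N p"] norm_e norm_N[OF that] Ne[OF that] by (simp add: inner_commute)
  text \<open>In the profile plane the tangent line reads \<open>s r + \<nu> z = h\<close> with \<open>s\<^sup>2 + \<nu>\<^sup>2 = 1\<close>.\<close>
  have line: "(h - \<nu> * z p)\<^sup>2 = (1 - \<nu>\<^sup>2) * (r p)\<^sup>2" if p: "p \<in> topspace M" for p
  proof -
    \<comment> \<open>Tangency of \<open>\<tau> p\<close> makes these two vectors parallel, so
      Cauchy-Schwarz holds with equality.\<close>
    have "cross3 (cross3 e (N p)) (\<tau> p) = 0"
    proof -
      have "cross3 (cross3 e (N p)) (cross3 e (F p - q)) = (N p \<bullet> \<tau> p) *\<^sub>R (- e)"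
        by (subst Lagrange) (simp add: dot_cross_self, simp add: cross3_simps)
      then show ?thesis using N_orthogonal_\<tau>[OF p] by simp
    qed
    then have "(cross3 e (N p) \<bullet> \<tau> p)\<^sup>2 = (norm (cross3 e (N p)))\<^sup>2 * (r p)\<^sup>2"
      using norm_cross_dot[of "cross3 e (N p)" "\<tau> p"] by (simp add: r_def power_mult_distrib)
    moreover have "cross3 e (N p) \<bullet> \<tau> p = h - \<nu> * z p"
      unfolding dot_cross using Ny[OF p] Ne[OF p] e_e by (simp add: z_def inner_commute)
    ultimately show ?thesis using eN[OF p] by simp
  qed
  \<comment> \<open>A point of the axis would have normal parallel to \<open>e\<close>, which forces
    \<open>\<nu>\<^sup>2 = 1\<close>.\<close>
  have r0: "r p \<noteq> 0" if p: "p \<in> topspace M" and "\<nu>\<^sup>2 \<noteq> 1" for p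
  proof
    assume "r p = 0"
    then have "N p = (e \<bullet> N p) *\<^sub>R e" using N_parallel_axis[OF p] by (simp add: r_def)
    then have "N p \<bullet> N p = (e \<bullet> N p) * (e \<bullet> N p)" by (metis inner_scaleR_left)
    then show False using N_N[OF p] Ne[OF p] that(2) by (simp add: inner_commute power2_eq_square)
  qed
  have \<nu>1: "\<nu>\<^sup>2 \<le> 1" using eN[OF p\<^sub>0] by (metis diff_ge_0_iff_ge zero_le_power2)
  \<comment> \<open>The profile is orthogonal to the axis, parallel to it, or oblique: plane,
    cylinder and cone respectively.\<close>
  consider "\<nu>\<^sup>2 = 1" | "\<nu> = 0" | "\<nu> \<noteq> 0" "\<nu>\<^sup>2 < 1" using \<nu>1 by fastforce
  then show ?thesis
  proof cases
    case 1
    define P where "P = {x. e \<bullet> (x - (q + (h / \<nu>) *\<^sub>R e)) = 0}"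
    have "\<nu> \<noteq> 0" using 1 by auto
    have "F p \<in> P" if "p \<in> topspace M" for p
      using line[OF that] 1 e_e \<open>\<nu> \<noteq> 0\<close>
      by (simp add: P_def z_def inner_diff_right inner_diff_left inner_add_right inner_commute field_simps)
    moreover have "plane P"
      unfolding plane_def P_def using e_e by (metis inner_zero_left zero_neq_one)
    ultimately show ?thesis by blast
  next
    case 2
    define Z where "Z = {x. norm (cross3 e (x - q)) = \<bar>h\<bar>}"
    have rh: "r p = \<bar>h\<bar>" if "p \<in> topspace M" for p
      using line[OF that] 2 by (simp add: r_def power2_eq_iff_nonneg abs_le_square_iff)
        (metis abs_norm_cancel power2_eq_iff abs_minus_cancel)
    have "\<bar>h\<bar> > 0" using rh[OF p\<^sub>0] r0[OF p\<^sub>0] 2 by simp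
    then have "cylinder Z" unfolding cylinder_def Z_def using norm_e by blast
    moreover have "F ` topspace M \<subseteq> Z" using rh by (auto simp: Z_def r_def)
    ultimately show ?thesis by blast
  next
    case 3
    \<comment> \<open>The apex: the line of the profile meets the axis at height
      \<open>h / \<nu>\<close>.\<close>
    define v where "v = q + (h / \<nu>) *\<^sub>R e"
    have ev: "e \<bullet> (F p - v) = z p - h / \<nu>" for p
      using e_e by (simp add: v_def z_def inner_diff_right inner_diff_left inner_add_right inner_commute)
    have hz: "h - \<nu> * z p = - \<nu> * (e \<bullet> (F p - v))" for p
      using 3 by (simp add: ev field_simps)
    have nv: "(e \<bullet> (F p - v))\<^sup>2 = (1 - \<nu>\<^sup>2) * (norm (F p - v))\<^sup>2" if p: "p \<in> topspace M" for p
    proof -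
      have "cross3 e (F p - v) = \<tau> p"
        by (simp add: v_def Cross3.right_diff_distrib cross_add_right cross_mult_right)
      then have "(norm (F p - v))\<^sup>2 = (r p)\<^sup>2 + (e \<bullet> (F p - v))\<^sup>2"
        using norm_cross[of e "F p - v"] norm_e by (simp add: r_def)
      moreover have "\<nu>\<^sup>2 * (e \<bullet> (F p - v))\<^sup>2 = (1 - \<nu>\<^sup>2) * (r p)\<^sup>2"
        using line[OF p] unfolding hz by (simp add: power_mult_distrib)
      ultimately show ?thesis by (simp add: algebra_simps)
    qed
    have ne0: "e \<bullet> (F p - v) \<noteq> 0" if p: "p \<in> topspace M" for p
      using line[OF p] r0[OF p] 3 unfolding hz by auto
    \<comment> \<open>The two nappes cut the surface into disjoint open parts, so connectedness
      leaves one of them; \<open>\<sigma>\<close> orients the cone axis towards it.\<close>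
    define Up where "Up = {p \<in> topspace M. e \<bullet> (F p - v) > 0}"
    define Lo where "Lo = {p \<in> topspace M. e \<bullet> (F p - v) < 0}"
    have "openin M Up" "openin M Lo" unfolding Up_def Lo_def
      by (intro openin_F_vimage open_Collect_less continuous_intros)+
    moreover have "Up \<union> Lo = topspace M" "Up \<inter> Lo = {}"
      using ne0 unfolding Up_def Lo_def by (force simp: not_less)+
    ultimately have "Up = {} \<or> Lo = {}" using con unfolding connected_space_eq by blast
    then obtain \<sigma> :: real where \<sigma>: "\<bar>\<sigma>\<bar> = 1" "\<And>p. p \<in> topspace M \<Longrightarrow> \<sigma> * (e \<bullet> (F p - v)) > 0"
    proof
      assume "Up = {}"
      then show ?thesis using that[of "-1"] ne0 unfolding Up_def by force
    next
      assume "Lo = {}"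
      then show ?thesis using that[of 1] ne0 unfolding Lo_def by force
    qed
    \<comment> \<open>By \<open>nv\<close>, the squared cosine of the angle between the axis and the
      line from the apex is \<open>1 - \<nu>\<^sup>2\<close>.\<close>
    define \<omega> where "\<omega> = arccos (sqrt (1 - \<nu>\<^sup>2))"
    have s: "0 < sqrt (1 - \<nu>\<^sup>2)" "sqrt (1 - \<nu>\<^sup>2) < 1" using 3 by simp_all
    have cos\<omega>: "cos \<omega> = sqrt (1 - \<nu>\<^sup>2)" unfolding \<omega>_def by (rule cos_arccos) (use s in linarith)+
    have "arccos 1 < \<omega>" "\<omega> < arccos 0"
      unfolding \<omega>_def by (rule arccos_less_arccos; use s in linarith)+
    then have \<omega>: "0 < \<omega>" "\<omega> < pi / 2" by simp_all
    define K where "K = {x. (\<sigma> *\<^sub>R e) \<bullet> (x - v) = cos \<omega> * norm (x - v)}"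
    have "norm (\<sigma> *\<^sub>R e) = 1" using \<sigma>(1) norm_e by simp
    then have "circular_cone K"
      unfolding circular_cone_def K_def using \<omega> by blast
    moreover have "F p \<in> K" if p: "p \<in> topspace M" for p
    proof -
      have "\<sigma>\<^sup>2 = 1" using \<sigma>(1) by (metis power2_abs power_one)
      then have "(\<sigma> * (e \<bullet> (F p - v)))\<^sup>2 = (cos \<omega> * norm (F p - v))\<^sup>2"
        using nv[OF p] 3 by (simp add: power_mult_distrib cos\<omega>)
      moreover have "0 \<le> cos \<omega> * norm (F p - v)" using s by (simp add: cos\<omega>)
      ultimately have "\<sigma> * (e \<bullet> (F p - v)) = cos \<omega> * norm (F p - v)"
        using \<sigma>(2)[OF p] by (simp add: power2_eq_iff_nonneg)
      then show ?thesis by (simp add: K_def)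
    qed
    ultimately show ?thesis by blast
  qed
qed

end

section \<open>Factoring the Weingarten relation\<close>

theorem theorem4p24:
  fixes M :: "'m topology" and F N :: "'m \<Rightarrow> real^3" and q e :: "real^3"
    and \<alpha> \<beta> \<gamma> \<delta> :: real
  assumes "oriented_C2_surface M F N"
    and "connected_space M"
    and "rotationally_symmetric M F q e"
    and "semi_quadratic_Weingarten M F N q e \<alpha> \<beta> \<gamma> \<delta>"
    and "(Lambda1 \<beta> \<gamma>)\<^sup>2 = Lambda2 \<alpha> \<beta> \<gamma> \<delta>"
  shows "\<exists>T. (torus_of_revolution T \<or> round_sphere T \<or> plane T \<or>
              circular_cone T \<or> cylinder T) \<and> F ` topspace M \<subseteq> T"
proof -
  have nz: "\<not> (\<alpha> = 0 \<and> \<beta> = 0 \<and> \<gamma> = 0 \<and> \<delta> = 0)"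
    and W: "\<And>p. p \<in> topspace M \<Longrightarrow> \<exists>k\<^sub>1 k\<^sub>2. parallel_curvature M F N q e p k\<^sub>1 \<and>
        profile_curvature M F N q e p k\<^sub>2 \<and>
        \<alpha> * k\<^sub>1 * k\<^sub>2 + \<beta> * k\<^sub>1 + \<gamma> * k\<^sub>2 + \<delta> = 0"
    using assms(4) unfolding semi_quadratic_Weingarten_def by blast+
  interpret rotational_surface M F N q e
    using assms(1,3) W by unfold_locales blast+
  have prod: "\<beta> * \<gamma> = \<alpha> * \<delta>"
    using assms(5) by (simp add: Lambda1_def Lambda2_def power2_eq_square algebra_simps)
  have "\<exists>a b. \<forall>k\<^sub>1 k\<^sub>2. \<alpha> * k\<^sub>1 * k\<^sub>2 + \<beta> * k\<^sub>1 + \<gamma> * k\<^sub>2 + \<delta> = 0 \<longrightarrow> k\<^sub>1 = a \<or> k\<^sub>2 = b"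
  proof (cases "\<alpha> = 0")
    case False
    have "k\<^sub>1 = - \<gamma> / \<alpha> \<or> k\<^sub>2 = - \<beta> / \<alpha>"
      if "\<alpha> * k\<^sub>1 * k\<^sub>2 + \<beta> * k\<^sub>1 + \<gamma> * k\<^sub>2 + \<delta> = 0" for k\<^sub>1 k\<^sub>2
    proof -
      \<comment> \<open>Multiplied by \<open>\<alpha>\<close>, the relation factors, because
        \<open>prod\<close> identifies the constant terms.\<close>
      have "(\<alpha> * k\<^sub>1 + \<gamma>) * (\<alpha> * k\<^sub>2 + \<beta>) = \<alpha> * (\<alpha> * k\<^sub>1 * k\<^sub>2 + \<beta> * k\<^sub>1 + \<gamma> * k\<^sub>2 + \<delta>)"
        using prod by (simp add: algebra_simps)
      then have "\<alpha> * k\<^sub>1 + \<gamma> = 0 \<or> \<alpha> * k\<^sub>2 + \<beta> = 0" using that by simp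
      then show ?thesis using False by (auto simp: field_simps eq_neg_iff_add_eq_0)
    qed
    then show ?thesis by blast
  next
    case True
    then have "\<beta> = 0 \<or> \<gamma> = 0" using prod by simp
    \<comment> \<open>If \<open>\<beta>\<close> or \<open>\<gamma>\<close> vanishes, its quotient is
      0 by convention, a harmless value: the alternative proved below always has a nonzero
      denominator. If both vanish, \<open>\<delta>\<close> is nonzero and the relation cannot
      hold.\<close>
    then have "k\<^sub>1 = - \<delta> / \<beta> \<or> k\<^sub>2 = - \<delta> / \<gamma>"
      if "\<beta> * k\<^sub>1 + \<gamma> * k\<^sub>2 + \<delta> = 0" for k\<^sub>1 k\<^sub>2
    proof -
      have "\<beta> \<noteq> 0 \<and> \<beta> * k\<^sub>1 = - \<delta> \<or> \<gamma> \<noteq> 0 \<and> \<gamma> * k\<^sub>2 = - \<delta>"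
        using \<open>\<beta> = 0 \<or> \<gamma> = 0\<close> that nz True by (auto simp: eq_neg_iff_add_eq_0)
      then show ?thesis by (metis nonzero_mult_div_cancel_left)
    qed
    then show ?thesis using True by auto
  qed
  then obtain a b where
    "\<And>k\<^sub>1 k\<^sub>2. \<alpha> * k\<^sub>1 * k\<^sub>2 + \<beta> * k\<^sub>1 + \<gamma> * k\<^sub>2 + \<delta> = 0 \<Longrightarrow> k\<^sub>1 = a \<or> k\<^sub>2 = b" by blast
  then have "\<exists>k\<^sub>1 k\<^sub>2. par p k\<^sub>1 \<and> prof p k\<^sub>2 \<and> (k\<^sub>1 = a \<or> k\<^sub>2 = b)" if "p \<in> topspace M" for p
    using W[OF that] by blast
  then obtain c where c: "\<And>p. p \<in> topspace M \<Longrightarrow> prof p c"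
    using profile_curvature_constant[OF assms(2)] by blast
  show ?thesis
    using torus_or_sphere_if_profile_curvature[OF assms(2) _ c]
      plane_cone_or_cylinder_if_profile_flat[OF assms(2)] c by metis
qed

end
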